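(* Let $W$ be a special $K(3)$-module. Then the bristle type of $W$ is $1$, $2$, $3$ or $\infty$. Moreover, depending on the bristle type, there are a basis $x,y,z$ of $E$, a basis $a,b,c$ of $W_0$ and a basis $d,e$ of $W_1$ such that the multiplication $E\otimes_k W_0\to W_1$ is given as follows (all products of basis elements not listed are zero), and the subbristles and bars of $W$ are as described, where $\langle\ldots\rangle$ denotes the $k$-span and the submodule generated by $w\in W_0$ is $(\langle w\rangle, Ew)$: - Bristle type $1$: $xa=d,\ xb=e,\ yb=d,\ yc=e,\ zc=d$. The only subbristle is the submodule generated by $a$; the only bar is $N=(\langle a,b\rangle, W_1)$, whose annihilator in $E$ is $\langle z\rangle$. - Bristle type $2$: $xa=d,\ xb=e,\ yb=d,\ zc=e$. The subbristles are exactly the submodules generated by $a$ and by $c$; the bars are exactly $(\langle a,b\rangle,W_1)$, with annihilator $\langle z\rangle$, and $(\langle a,c\rangle,W_1)$, with annihilator $\langle y\rangle$. - Bristle type $3$: $xa=d,\ yb=d+e,\ zc=e$. The subbristles are exactly the submodules generated by $a$, by $b$ and by $c$; the bars are exactly $(\langle a,b\rangle,W_1)$, $(\langle a,c\rangle,W_1)$, $(\langle b,c\rangle,W_1)$, with annihilators $\langle z\rangle$, $\langle y\rangle$, $\langle x\rangle$, respectively. - Bristle type $\infty$: $xa=d,\ xb=e,\ yc=e,\ zc=d$. The subbristles are exactly the submodules generated by a non-zero element of $\langle a,b\rangle$; the only bar is $(\langle a,b\rangle,W_1)$, with annihilator $\langle y,z\rangle$.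
   Context: $k$ is an algebraically closed field and $E$ is a $3$-dimensional $k$-vector space (the arrow space of the $3$-Kronecker quiver $K(3)$, which has two vertices $0,1$ and three arrows $0\to 1$). A $K(3)$-module is a triple $M=(M_0,M_1;\phi_M\colon E\otimes_k M_0\to M_1)$ with finite-dimensional vector spaces $M_0,M_1$ and $\phi_M$ linear; write $em=\phi_M(e\otimes m)$. Homomorphisms are pairs of linear maps compatible with the maps $\phi$; the submodule with components $U_0\subseteq M_0$, $U_1\subseteq M_1$ (where $EU_0\subseteq U_1$) is denoted $(U_0,U_1)$. The dimension vector is $(\dim M_0,\dim M_1)$. The annihilator of $M$ in $E$ is $\{e\in E\mid eM_0=0\}$; $M$ is faithful if this annihilator is zero. A $K(3)$-module $W$ is special if its dimension vector is $(3,2)$, $W$ is faithful and $\operatorname{End}(W)=k$. A subbristle of $W$ is an indecomposable submodule of length $2$. A bar in $W$ is a submodule of dimension vector $(2,2)$ that is not faithful. The bristle type of a special $K(3)$-module is the number of its subbristles (written $\infty$ if there are infinitely many). *)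

theory Defs
  imports
    "HOL-Computational_Algebra.Polynomial"
    "HOL-Library.Extended_Nat"
    "HOL-Library.Product_Order"
begin

text \<open>
  A record \<open>M\<close> carries the data of a \<open>K(3)\<close>-module whose two vector spaces are the full types
  \<open>'u\<close> and \<open>'v\<close>. The linear map \<open>E \<otimes> M\<^sub>0 \<rightarrow> M\<^sub>1\<close> is given by the corresponding bilinear map \<open>act M\<close>,
  so that \<open>act M e m\<close> is the product \<open>e m\<close>. The space \<open>E\<close> is the full type \<open>'e\<close> with scalar
  multiplication \<open>sE\<close>.
\<close>

record ('k, 'e, 'u, 'v) K3_data =
  scale0 :: "'k \<Rightarrow> 'u \<Rightarrow> 'u"
  scale1 :: "'k \<Rightarrow> 'v \<Rightarrow> 'v"
  act :: "'e \<Rightarrow> 'u \<Rightarrow> 'v"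

definition K3_module ::
  "('k::field \<Rightarrow> 'e::ab_group_add \<Rightarrow> 'e) \<Rightarrow>
   ('k, 'e, 'u::ab_group_add, 'v::ab_group_add) K3_data \<Rightarrow> bool" where
  "K3_module sE M \<longleftrightarrow>
     (\<exists>B. finite_dimensional_vector_space sE B) \<and> vector_space.dim sE UNIV = 3 \<and>
     (\<exists>B. finite_dimensional_vector_space (scale0 M) B) \<and>
     (\<exists>B. finite_dimensional_vector_space (scale1 M) B) \<and>
     (\<forall>e. Vector_Spaces.linear (scale0 M) (scale1 M) (\<lambda>m. act M e m)) \<and>
     (\<forall>m. Vector_Spaces.linear sE (scale1 M) (\<lambda>e. act M e m))"

text \<open>
  Submodules are pairs of subspaces, ordered componentwise by inclusion. The notions below that
  depend only on a module in its own right are defined for submodules \<open>U\<close> of \<open>M\<close>;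
  for \<open>M\<close> itself take \<open>U = (UNIV, UNIV)\<close>.
\<close>

definition submodule ::
  "('k::field, 'e, 'u::ab_group_add, 'v::ab_group_add) K3_data \<Rightarrow> 'u set \<times> 'v set \<Rightarrow> bool" where
  "submodule M U \<longleftrightarrow>
     module.subspace (scale0 M) (fst U) \<and> module.subspace (scale1 M) (snd U) \<and>
     (\<forall>e. \<forall>m\<in>fst U. act M e m \<in> snd U)"

definition zero_sub :: "'u::zero set \<times> 'v::zero set" where
  "zero_sub = ({0}, {0})"

definition dim_vector ::
  "('k::field, 'e, 'u::ab_group_add, 'v::ab_group_add) K3_data \<Rightarrow> 'u set \<times> 'v set \<Rightarrow> nat \<times> nat" where
  "dim_vector M U = (vector_space.dim (scale0 M) (fst U), vector_space.dim (scale1 M) (snd U))"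

definition annihilator ::
  "('k, 'e, 'u, 'v::zero) K3_data \<Rightarrow> 'u set \<times> 'v set \<Rightarrow> 'e set" where
  "annihilator M U = {e. \<forall>m\<in>fst U. act M e m = 0}"

definition faithful ::
  "('k, 'e::zero, 'u, 'v::zero) K3_data \<Rightarrow> 'u set \<times> 'v set \<Rightarrow> bool" where
  "faithful M U \<longleftrightarrow> annihilator M U = {0}"

definition endomorphisms ::
  "('k::field, 'e, 'u::ab_group_add, 'v::ab_group_add) K3_data \<Rightarrow> (('u \<Rightarrow> 'u) \<times> ('v \<Rightarrow> 'v)) set" where
  "endomorphisms M =
     {(f, g). Vector_Spaces.linear (scale0 M) (scale0 M) f \<and>
              Vector_Spaces.linear (scale1 M) (scale1 M) g \<and>
              (\<forall>e m. g (act M e m) = act M e (f m))}"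

text \<open>The last conjunct is \<open>End W = k\<close>: every endomorphism is multiplication by a scalar.\<close>

definition special ::
  "('k::field \<Rightarrow> 'e::ab_group_add \<Rightarrow> 'e) \<Rightarrow>
   ('k, 'e, 'u::ab_group_add, 'v::ab_group_add) K3_data \<Rightarrow> bool" where
  "special sE W \<longleftrightarrow>
     K3_module sE W \<and> dim_vector W (UNIV, UNIV) = (3, 2) \<and> faithful W (UNIV, UNIV) \<and>
     endomorphisms W = range (\<lambda>c. (scale0 W c, scale1 W c))"

definition direct_sum_of ::
  "'u::ab_group_add set \<times> 'v::ab_group_add set \<Rightarrow> 'u set \<times> 'v set \<Rightarrow> 'u set \<times> 'v set \<Rightarrow> bool" where
  "direct_sum_of U A B \<longleftrightarrow>
     fst U = {a + b |a b. a \<in> fst A \<and> b \<in> fst B} \<and> fst A \<inter> fst B = {0} \<and>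
     snd U = {a + b |a b. a \<in> snd A \<and> b \<in> snd B} \<and> snd A \<inter> snd B = {0}"

definition indecomposable ::
  "('k::field, 'e, 'u::ab_group_add, 'v::ab_group_add) K3_data \<Rightarrow> 'u set \<times> 'v set \<Rightarrow> bool" where
  "indecomposable M U \<longleftrightarrow>
     U \<noteq> zero_sub \<and>
     (\<forall>A B. submodule M A \<longrightarrow> submodule M B \<longrightarrow> direct_sum_of U A B \<longrightarrow> A = zero_sub \<or> B = zero_sub)"

text \<open>\<open>U\<close> has a composition series with \<open>n\<close> factors.\<close>

definition has_length ::
  "('k::field, 'e, 'u::ab_group_add, 'v::ab_group_add) K3_data \<Rightarrow> 'u set \<times> 'v set \<Rightarrow> nat \<Rightarrow> bool" where
  "has_length M U n \<longleftrightarrow>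
     (\<exists>C. C 0 = zero_sub \<and> C n = U \<and> (\<forall>i\<le>n. submodule M (C i)) \<and>
          (\<forall>i<n. C i < C (Suc i) \<and> \<not> (\<exists>X. submodule M X \<and> C i < X \<and> X < C (Suc i))))"

definition subbristles ::
  "('k::field, 'e, 'u::ab_group_add, 'v::ab_group_add) K3_data \<Rightarrow> ('u set \<times> 'v set) set" where
  "subbristles W = {U. submodule W U \<and> indecomposable W U \<and> has_length W U 2}"

definition bars ::
  "('k::field, 'e::zero, 'u::ab_group_add, 'v::ab_group_add) K3_data \<Rightarrow> ('u set \<times> 'v set) set" where
  "bars W = {U. submodule W U \<and> dim_vector W U = (2, 2) \<and> \<not> faithful W U}"

definition bristle_type ::
  "('k::field, 'e, 'u::ab_group_add, 'v::ab_group_add) K3_data \<Rightarrow> enat" where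
  "bristle_type W = (if finite (subbristles W) then enat (card (subbristles W)) else \<infinity>)"

definition generated ::
  "('k::field, 'e, 'u::ab_group_add, 'v::ab_group_add) K3_data \<Rightarrow> 'u \<Rightarrow> 'u set \<times> 'v set" where
  "generated M w = (module.span (scale0 M) {w}, range (\<lambda>e. act M e w))"

definition basis_list :: "('k::field \<Rightarrow> 'a::ab_group_add \<Rightarrow> 'a) \<Rightarrow> 'a list \<Rightarrow> bool" where
  "basis_list s xs \<longleftrightarrow>
     distinct xs \<and> \<not> module.dependent s (set xs) \<and> module.span s (set xs) = UNIV"

end

theory Submission
  imports Defs
begin

text \<open>
  The two coordinates of the multiplication \<open>E \<otimes> W\<^sub>0 \<rightarrow> W\<^sub>1\<close> form a pencil of \<open>3 \<times> 3\<close>-matrices. Over an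
  algebraically closed field the pencil contains a singular matrix, and a kernel vector \<open>a\<close> of it
  generates a bristle: \<open>Ea = \<langle>d\<rangle>\<close>. Choose \<open>x\<close> with \<open>xa = d\<close> and a basis \<open>y, z\<close> of the annihilator of \<open>a\<close>.
  What remains is the \<open>2 \<times> 2\<close>-pencil given by \<open>\<langle>y, z\<rangle> \<times> W\<^sub>0/\<langle>a\<rangle> \<rightarrow> W\<^sub>1\<close> together with the action of \<open>x\<close>, and
  it is normalised by hand according to the rank of its component in \<open>W\<^sub>1/\<langle>d\<rangle>\<close>. Rank \<open>0\<close> and the degenerate
  cases in rank \<open>1\<close> and \<open>2\<close> admit a nonscalar endomorphism, all others lead to one of the four tables.
  For a given table, the elements \<open>w\<close> with \<open>dim Ew = 1\<close> (the generators of subbristles) and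
  the elements of \<open>E\<close> of rank one (which correspond to bars) are found by setting all
  \<open>2 \<times> 2\<close>-minors to zero.
\<close>

section \<open>Bases with two or three elements\<close>

text \<open>Once \<open>a\<close>, \<open>d\<close> and the annihilator of \<open>a\<close> are
  fixed, the remaining freedom is block triangular. The products of \<open>y, z\<close> with
  \<open>b, c\<close> split into a matrix P of coefficients at \<open>d\<close> and a matrix Q of
  coefficients at \<open>e\<close>; replacing \<open>e\<close> by \<open>e - t d\<close> turns P
  into P + tQ. If Q is invertible, it can be made the identity, and then P matters only up to
  conjugation. With t chosen to make P singular, P has eigenvalues 0 and s: s nonzero gives type 3,
  a nonzero nilpotent P gives type 2, and P = 0 splits off the bristle. If Q has rank one, the types
  1, 2 and infinity arise. Type 2 occurs twice because its two bristles look different when used as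
  starting point. The tables are self-certifying: independence of \<open>x, y, z\<close> and of
  \<open>a, b, c\<close> can be read off the products, so only the basis \<open>d, e\<close> has to
  be carried along. The tables have four different bristle types, so computing the type of each one
  decides which implication of the theorem is at stake. Algebraic closure enters three times: a root
  of a cubic, a root of a quadratic, and infinitely many scalars.\<close>

context vector_space
begin

text \<open>\<open>distinct\<close> has to be included because \<open>{a, b}\<close> collapses to a
  singleton when \<open>a = b\<close>, and a nonzero singleton is independent.\<close>

lemma independent_pair_iff:
  "distinct [a, b] \<and> independent {a, b} \<longleftrightarrow>
    (\<forall>\<alpha> \<beta>. \<alpha> *s a + \<beta> *s b = 0 \<longrightarrow> \<alpha> = 0 \<and> \<beta> = 0)"
proof
  assume L: "distinct [a, b] \<and> independent {a, b}"
  then have b: "b \<noteq> 0" and a: "a \<notin> span {b}"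
    by (auto simp: independent_insert split: if_splits)
  show "\<forall>\<alpha> \<beta>. \<alpha> *s a + \<beta> *s b = 0 \<longrightarrow> \<alpha> = 0 \<and> \<beta> = 0"
  proof (intro allI impI)
    fix \<alpha> \<beta> assume *: "\<alpha> *s a + \<beta> *s b = 0"
    have "\<alpha> *s a = (- \<beta>) *s b"
      using * by (simp add: eq_neg_iff_add_eq_0)
    then have "\<alpha> *s a \<in> span {b}"
      by (metis span_base insertI1 span_scale)
    then have "\<alpha> = 0"
      using a by (metis scale_one left_inverse scale_scale span_scale)
    with * b show "\<alpha> = 0 \<and> \<beta> = 0" by simp
  qed
next
  assume R: "\<forall>\<alpha> \<beta>. \<alpha> *s a + \<beta> *s b = 0 \<longrightarrow> \<alpha> = 0 \<and> \<beta> = 0"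
  have b: "b \<noteq> 0"
    using R[rule_format, of 0 1] by auto
  have a: "a \<notin> span {b}"
  proof
    assume "a \<in> span {b}"
    then obtain k where "a = k *s b" by (auto simp: span_singleton)
    then show False using R[rule_format, of 1 "- k"] by simp
  qed
  have "a \<noteq> b" using a span_base[of b "{b}"] by auto
  then show "distinct [a, b] \<and> independent {a, b}"
    using a b by (simp add: independent_insert)
qed

lemma independent_triple_iff:
  "distinct [a, b, c] \<and> independent {a, b, c} \<longleftrightarrow>
    (\<forall>\<alpha> \<beta> \<gamma>. \<alpha> *s a + \<beta> *s b + \<gamma> *s c = 0 \<longrightarrow> \<alpha> = 0 \<and> \<beta> = 0 \<and> \<gamma> = 0)"
proof
  assume L: "distinct [a, b, c] \<and> independent {a, b, c}"
  then have bc: "distinct [b, c] \<and> independent {b, c}" and a: "a \<notin> span {b, c}"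
    by (auto simp: independent_insert split: if_splits)
  show "\<forall>\<alpha> \<beta> \<gamma>. \<alpha> *s a + \<beta> *s b + \<gamma> *s c = 0 \<longrightarrow> \<alpha> = 0 \<and> \<beta> = 0 \<and> \<gamma> = 0"
  proof (intro allI impI)
    fix \<alpha> \<beta> \<gamma> assume *: "\<alpha> *s a + \<beta> *s b + \<gamma> *s c = 0"
    have "\<alpha> *s a = (- \<beta>) *s b + (- \<gamma>) *s c"
      using * by (simp add: eq_neg_iff_add_eq_0 algebra_simps)
    then have "\<alpha> *s a \<in> span {b, c}"
      by (metis span_base insertI1 insertI2 span_scale span_add)
    then have "\<alpha> = 0"
      using a by (metis scale_one left_inverse scale_scale span_scale)
    with * bc show "\<alpha> = 0 \<and> \<beta> = 0 \<and> \<gamma> = 0" unfolding independent_pair_iff by simp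
  qed
next
  assume R: "\<forall>\<alpha> \<beta> \<gamma>. \<alpha> *s a + \<beta> *s b + \<gamma> *s c = 0 \<longrightarrow> \<alpha> = 0 \<and> \<beta> = 0 \<and> \<gamma> = 0"
  have bc: "distinct [b, c] \<and> independent {b, c}"
    unfolding independent_pair_iff using R[rule_format, of 0] by simp
  have a: "a \<notin> span {b, c}"
  proof
    assume "a \<in> span {b, c}"
    then obtain k l where "a - k *s b = l *s c" by (auto simp: span_singleton span_breakdown_eq)
    then have "1 *s a + (- k) *s b + (- l) *s c = 0" by (simp add: diff_eq_eq)
    then show False using R[rule_format, of 1 "- k" "- l"] by simp
  qed
  have "a \<noteq> b" "a \<noteq> c" using a span_base[of _ "{b, c}"] by auto
  then show "distinct [a, b, c] \<and> independent {a, b, c}"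
    using a bc by (auto simp: independent_insert)
qed

lemma in_span_pair_iff: "v \<in> span {a, b} \<longleftrightarrow> (\<exists>\<alpha> \<beta>. v = \<alpha> *s a + \<beta> *s b)"
  by (simp add: span_breakdown_eq span_singleton image_iff diff_eq_eq add.commute)

lemma in_span_triple_iff:
  "v \<in> span {a, b, c} \<longleftrightarrow> (\<exists>\<alpha> \<beta> \<gamma>. v = \<alpha> *s a + \<beta> *s b + \<gamma> *s c)"
  unfolding span_breakdown_eq[of v a] in_span_pair_iff
  by (metis add.assoc add.commute diff_eq_eq)

lemma basis_list_pairD:
  assumes "basis_list (*s) [a, b]"
  shows "\<alpha> *s a + \<beta> *s b = \<alpha>' *s a + \<beta>' *s b \<longleftrightarrow> \<alpha> = \<alpha>' \<and> \<beta> = \<beta>'"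
    and "\<exists>\<alpha> \<beta>. v = \<alpha> *s a + \<beta> *s b"
proof -
  have "(\<alpha> - \<alpha>') *s a + (\<beta> - \<beta>') *s b = (\<alpha> *s a + \<beta> *s b) - (\<alpha>' *s a + \<beta>' *s b)"
    by (simp add: scale_left_diff_distrib)
  moreover have "\<forall>\<alpha> \<beta>. \<alpha> *s a + \<beta> *s b = 0 \<longrightarrow> \<alpha> = 0 \<and> \<beta> = 0"
    using assms independent_pair_iff[of a b] by (simp add: basis_list_def)
  ultimately show "\<alpha> *s a + \<beta> *s b = \<alpha>' *s a + \<beta>' *s b \<longleftrightarrow> \<alpha> = \<alpha>' \<and> \<beta> = \<beta>'"
    by (metis right_minus_eq)
  show "\<exists>\<alpha> \<beta>. v = \<alpha> *s a + \<beta> *s b"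
    using assms in_span_pair_iff[of v a b] by (simp add: basis_list_def)
qed

lemma basis_list_tripleD:
  assumes "basis_list (*s) [a, b, c]"
  shows "\<alpha> *s a + \<beta> *s b + \<gamma> *s c = 0 \<Longrightarrow> \<alpha> = 0 \<and> \<beta> = 0 \<and> \<gamma> = 0"
    and "\<exists>\<alpha> \<beta> \<gamma>. v = \<alpha> *s a + \<beta> *s b + \<gamma> *s c"
proof -
  have "\<forall>\<alpha> \<beta> \<gamma>. \<alpha> *s a + \<beta> *s b + \<gamma> *s c = 0 \<longrightarrow> \<alpha> = 0 \<and> \<beta> = 0 \<and> \<gamma> = 0"
    using assms independent_triple_iff[of a b c] by (simp add: basis_list_def)
  then show "\<alpha> *s a + \<beta> *s b + \<gamma> *s c = 0 \<Longrightarrow> \<alpha> = 0 \<and> \<beta> = 0 \<and> \<gamma> = 0"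
    by blast
  show "\<exists>\<alpha> \<beta> \<gamma>. v = \<alpha> *s a + \<beta> *s b + \<gamma> *s c"
    using assms in_span_triple_iff[of v a b c] by (simp add: basis_list_def)
qed

lemma basis_list_triple_independent:
  assumes "basis_list (*s) [a, b, c]"
  shows "a \<noteq> b" "a \<noteq> c" "b \<noteq> c" "independent {a, b}" "independent {a, c}" "independent {b, c}"
    "a \<noteq> 0" "b \<noteq> 0" "c \<noteq> 0"
  using assms dependent_zero[of "{a, b, c}"] independent_mono[of "{a, b, c}"]
  by (auto simp: basis_list_def)

lemma subspace_singleton_cases:
  assumes "subspace S" "S \<subseteq> span {v}"
  shows "S = {0} \<or> S = span {v}"
proof (cases "S \<subseteq> {0}")
  case True
  then show ?thesis using subspace_0[OF assms(1)] by auto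
next
  case False
  then obtain w where w: "w \<in> S" "w \<noteq> 0" by auto
  then obtain k where k: "w = k *s v" using assms(2) by (auto simp: span_singleton)
  with w have "v = inverse k *s w" by auto
  then have "v \<in> S" using subspace_scale[OF assms(1) w(1)] by simp
  then show ?thesis using span_minimal[of "{v}" S] assms by auto
qed

text \<open>Needed at the vertex 1, where every subspace is a submodule, so that a linear complement
  already gives a decomposition of modules.\<close>

lemma subspace_complement_span_singleton:
  assumes "subspace S" "v \<in> S"
  obtains T where "subspace T" "S = {a + b |a b. a \<in> span {v} \<and> b \<in> T}" "span {v} \<inter> T = {0}"
proof (cases "v = 0")
  case True
  show ?thesis
    by (rule that[of S]) (use True assms subspace_0[OF assms(1)] in auto)
next
  case False
  then have "independent {v}" by simp
  then obtain B where B: "{v} \<subseteq> B" "B \<subseteq> S" "independent B" "S \<subseteq> span B"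
    using maximal_independent_subset_extend[of "{v}" S] assms by blast
  have SB: "S = span B" using B assms(1) span_minimal by blast
  let ?T = "span (B - {v})"
  have vT: "v \<notin> ?T" using B(1,3) by (auto simp: dependent_def)
  have "x \<in> S \<longleftrightarrow> (\<exists>a b. x = a + b \<and> a \<in> span {v} \<and> b \<in> ?T)" for x
  proof -
    have "x \<in> S \<longleftrightarrow> (\<exists>k. x - k *s v \<in> ?T)"
      using span_breakdown_eq[of x v "B - {v}"] B(1) SB by (simp add: insert_absorb)
    also have "\<dots> \<longleftrightarrow> (\<exists>a b. x = a + b \<and> a \<in> span {v} \<and> b \<in> ?T)"
    proof
      assume "\<exists>k. x - k *s v \<in> ?T"
      then obtain k where "x - k *s v \<in> ?T" ..
      moreover have "x = k *s v + (x - k *s v)" by simp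
      ultimately show "\<exists>a b. x = a + b \<and> a \<in> span {v} \<and> b \<in> ?T"
        unfolding span_singleton by blast
    next
      assume "\<exists>a b. x = a + b \<and> a \<in> span {v} \<and> b \<in> ?T"
      then obtain k b where "x = k *s v + b" "b \<in> ?T" by (auto simp: span_singleton)
      then have "x - k *s v \<in> ?T" by simp
      then show "\<exists>k. x - k *s v \<in> ?T" ..
    qed
    finally show ?thesis .
  qed
  then have "S = {a + b |a b. a \<in> span {v} \<and> b \<in> ?T}" by blast
  moreover have "span {v} \<inter> ?T = {0}"
  proof -
    have "k = 0" if "k *s v \<in> ?T" for k
      using that vT by (metis scale_one left_inverse scale_scale span_scale)
    then show ?thesis using span_zero by (auto simp: span_singleton)
  qed
  ultimately show ?thesis using that[of ?T] by auto
qed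

end

section \<open>Changes of basis in finite dimension\<close>

context finite_dimensional_vector_space
begin

lemma basis_list_iff:
  assumes "dim UNIV = length xs"
  shows "basis_list (*s) xs \<longleftrightarrow> distinct xs \<and> independent (set xs)"
proof -
  have "span (set xs) = UNIV" if "distinct xs" "independent (set xs)"
    using card_ge_dim_independent[of "set xs" UNIV] that assms
    by (auto simp: distinct_card simp del: dim_UNIV)
  then show ?thesis unfolding basis_list_def by blast
qed

lemma basis_list_pairI:
  assumes "dim UNIV = 2"
    and "\<And>\<alpha> \<beta>. \<alpha> *s a + \<beta> *s b = 0 \<Longrightarrow> \<alpha> = 0 \<and> \<beta> = 0"
  shows "basis_list (*s) [a, b]"
  using independent_pair_iff[of a b] assms by (simp add: basis_list_iff del: dim_UNIV)

lemma basis_list_tripleI: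
  assumes "dim UNIV = 3"
    and "\<And>\<alpha> \<beta> \<gamma>. \<alpha> *s a + \<beta> *s b + \<gamma> *s c = 0 \<Longrightarrow> \<alpha> = 0 \<and> \<beta> = 0 \<and> \<gamma> = 0"
  shows "basis_list (*s) [a, b, c]"
  using independent_triple_iff[of a b c] assms by (simp add: basis_list_iff del: dim_UNIV)

lemma extend_basis:
  assumes "independent (set xs)" "distinct xs"
  obtains ys where "basis_list (*s) (xs @ ys)" "length (xs @ ys) = dim UNIV"
proof -
  obtain B where B: "set xs \<subseteq> B" "independent B" "span B = UNIV"
    by (metis maximal_independent_subset_extend[OF subset_UNIV assms(1)] top.extremum_unique)
  have "finite B" using B(2) finiteI_independent by blast
  then obtain ys where ys: "set ys = B - set xs" "distinct ys"
    using finite_distinct_list by (metis finite_Diff)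
  have s: "set (xs @ ys) = B" "distinct (xs @ ys)" using ys B assms by auto
  have bl: "basis_list (*s) (xs @ ys)" unfolding basis_list_def s(1) using B s by simp
  have "length (xs @ ys) = dim UNIV"
    using B dim_eq_card[of B UNIV] s distinct_card[of "xs @ ys"] by (simp del: dim_UNIV)
  with bl that show ?thesis by blast
qed

lemma basis_list_length:
  assumes "basis_list (*s) xs"
  shows "dim UNIV = length xs"
proof -
  have "card (set xs) = dim UNIV"
    using assms by (intro basis_card_eq_dim) (auto simp: basis_list_def simp del: dim_UNIV)
  then show ?thesis using assms by (simp add: basis_list_def distinct_card del: dim_UNIV)
qed

text \<open>The vector \<open>a\<close> is kept, so only the 2 x 2 block on \<open>b, c\<close> has
  to be invertible, and the multiples \<open>m\<close> and \<open>m'\<close> of \<open>a\<close> are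
  free. The same statement serves \<open>x, y, z\<close> in \<open>E\<close> and
  \<open>a, b, c\<close> in the space at vertex 0.\<close>

lemma basis_list_triple_change_tail:
  assumes bas: "basis_list (*s) [a, b, c]" and det: "k * l' \<noteq> l * k'"
  shows "basis_list (*s) [a, k *s b + l *s c + m *s a, k' *s b + l' *s c + m' *s a]"
proof (rule basis_list_tripleI)
  show "dim UNIV = 3" using basis_list_length[OF bas] by simp
next
  fix \<alpha> \<beta> \<gamma>
  assume "\<alpha> *s a + \<beta> *s (k *s b + l *s c + m *s a) + \<gamma> *s (k' *s b + l' *s c + m' *s a) = 0"
  then have "(\<alpha> + \<beta> * m + \<gamma> * m') *s a + (\<beta> * k + \<gamma> * k') *s b + (\<beta> * l + \<gamma> * l') *s c = 0"
    by (simp add: scale_right_distrib scale_left_distrib ac_simps)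
  from basis_list_tripleD(1)[OF bas this]
  have *: "\<beta> * k + \<gamma> * k' = 0" "\<beta> * l + \<gamma> * l' = 0" "\<alpha> + \<beta> * m + \<gamma> * m' = 0" by auto
  \<comment> \<open>Cramer's rule: eliminating one unknown leaves the other one times the
    determinant.\<close>
  have "\<beta> * (k * l' - l * k') = 0" "\<gamma> * (k * l' - l * k') = 0"
    using *(1,2) by algebra+
  then have "\<beta> = 0" "\<gamma> = 0" using det by auto
  then show "\<alpha> = 0 \<and> \<beta> = 0 \<and> \<gamma> = 0" using *(3) by simp
qed

lemma basis_list_triple_change_head:
  assumes bas: "basis_list (*s) [a, b, c]"
  shows "basis_list (*s) [a + k *s b + l *s c, b, c]"
proof (rule basis_list_tripleI)
  show "dim UNIV = 3" using basis_list_length[OF bas] by simp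
next
  fix \<alpha> \<beta> \<gamma>
  assume "\<alpha> *s (a + k *s b + l *s c) + \<beta> *s b + \<gamma> *s c = 0"
  then have "\<alpha> *s a + (\<beta> + \<alpha> * k) *s b + (\<gamma> + \<alpha> * l) *s c = 0"
    by (simp add: scale_right_distrib scale_left_distrib ac_simps)
  from basis_list_tripleD(1)[OF bas this]
  show "\<alpha> = 0 \<and> \<beta> = 0 \<and> \<gamma> = 0" by auto
qed

lemma extend_basis_triple:
  assumes "dim UNIV = 3" "a \<noteq> 0"
  obtains b c where "basis_list (*s) [a, b, c]"
proof -
  obtain ys where ys: "basis_list (*s) ([a] @ ys)" "length ([a] @ ys) = dim UNIV"
    using extend_basis[of "[a]"] assms(2) by (metis distinct_singleton dependent_single empty_set list.simps(15))
  then obtain b c where "ys = [b, c]"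
    unfolding assms(1) by (auto simp: numeral_eq_Suc length_Suc_conv)
  then show ?thesis using ys that by simp
qed

lemma extend_basis_pair:
  assumes "dim UNIV = 2" "a \<noteq> 0"
  obtains b where "basis_list (*s) [a, b]"
proof -
  obtain ys where ys: "basis_list (*s) ([a] @ ys)" "length ([a] @ ys) = dim UNIV"
    using extend_basis[of "[a]"] assms(2) by (metis distinct_singleton dependent_single empty_set list.simps(15))
  then obtain b where "ys = [b]"
    unfolding assms(1) by (auto simp: numeral_eq_Suc length_Suc_conv)
  then show ?thesis using ys that by simp
qed

lemma basis_list_pair_change:
  assumes bas: "basis_list (*s) [a, b]" and det: "k * l' \<noteq> l * k'"
  shows "basis_list (*s) [k *s a + l *s b, k' *s a + l' *s b]"
proof (rule basis_list_pairI)
  show "dim UNIV = 2" using basis_list_length[OF bas] by simp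
next
  fix \<alpha> \<beta>
  assume "\<alpha> *s (k *s a + l *s b) + \<beta> *s (k' *s a + l' *s b) = 0"
  then have "(\<alpha> * k + \<beta> * k') *s a + (\<alpha> * l + \<beta> * l') *s b = 0 *s a + 0 *s b"
    by (simp add: scale_right_distrib scale_left_distrib ac_simps)
  then have *: "\<alpha> * k + \<beta> * k' = 0" "\<alpha> * l + \<beta> * l' = 0"
    unfolding basis_list_pairD(1)[OF bas] by auto
  have "\<alpha> * (k * l' - l * k') = 0" "\<beta> * (k * l' - l * k') = 0"
    using * by algebra+
  then show "\<alpha> = 0 \<and> \<beta> = 0" using det by simp
qed

end

section \<open>Special modules\<close>

context vector_space_pair
begin

lemma linear_extend_pair:
  assumes "basis_list s1 [a, b]"
  shows "\<exists>f. Vector_Spaces.linear s1 s2 f \<and> f a = a' \<and> f b = b'"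
  \<comment> \<open>The default \<open>b'\<close> is the value at \<open>b\<close>; distinctness
    keeps the update at \<open>a\<close> from overwriting it.\<close>
  using linear_independent_extend[of "{a, b}" "(\<lambda>_. b')(a := a')"] assms
  by (auto simp: basis_list_def)

lemma linear_extend_triple:
  assumes "basis_list s1 [a, b, c]"
  shows "\<exists>f. Vector_Spaces.linear s1 s2 f \<and> f a = a' \<and> f b = b' \<and> f c = c'"
  using linear_independent_extend[of "{a, b, c}" "(\<lambda>_. c')(a := a', b := b')"] assms
  by (auto simp: basis_list_def)

end

text \<open>\<open>BE\<close>, \<open>BU\<close> and \<open>BV\<close> appear because
  \<open>finite_dimensional_vector_space\<close> takes a basis as a parameter; they are unrelated to
  the bases of the normal forms.\<close>

locale special_module =
  E: finite_dimensional_vector_space sE BE +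
  U: finite_dimensional_vector_space "scale0 W" BU +
  V: finite_dimensional_vector_space "scale1 W" BV
  for sE :: "'k::field \<Rightarrow> 'e::ab_group_add \<Rightarrow> 'e" (infixr "*\<^sub>E" 75)
    and W :: "('k, 'e, 'u::ab_group_add, 'v::ab_group_add) K3_data"
    and BE BU BV +
  assumes special: "special sE W"

lemma special_imp_special_module:
  assumes "special sE W"
  obtains BE BU BV where "special_module sE W BE BU BV"
proof -
  obtain BE BU BV where "finite_dimensional_vector_space sE BE"
    "finite_dimensional_vector_space (scale0 W) BU" "finite_dimensional_vector_space (scale1 W) BV"
    using assms unfolding special_def K3_module_def by blast
  then show ?thesis
    using that assms by (simp add: special_module_def special_module_axioms_def)
qed

context special_module
begin

abbreviation scale_U (infixr "*\<^sub>U" 75) where "scale_U \<equiv> scale0 W"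
abbreviation scale_V (infixr "*\<^sub>V" 75) where "scale_V \<equiv> scale1 W"
abbreviation act_W (infixl "\<bullet>" 80) where "act_W \<equiv> act W"

sublocale UU: vector_space_pair scale_U scale_U by unfold_locales
sublocale VV: vector_space_pair scale_V scale_V by unfold_locales
sublocale UV: vector_space_pair scale_U scale_V by unfold_locales
sublocale EV: vector_space_pair "(*\<^sub>E)" scale_V by unfold_locales

lemma dim_E: "E.dim UNIV = 3" and dim_U: "U.dim UNIV = 3" and dim_V: "V.dim UNIV = 2"
  using special unfolding special_def K3_module_def dim_vector_def by (simp_all del: E.dim_UNIV U.dim_UNIV V.dim_UNIV)

lemma linear_act_right: "Vector_Spaces.linear (scale0 W) (scale1 W) (\<lambda>m. e \<bullet> m)"
  and linear_act_left: "Vector_Spaces.linear sE (scale1 W) (\<lambda>e. e \<bullet> m)"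
  using special unfolding special_def K3_module_def by auto

lemma act_simps [simp]:
  "(e + e') \<bullet> m = e \<bullet> m + e' \<bullet> m" "e \<bullet> (m + m') = e \<bullet> m + e \<bullet> m'"
  "(k *\<^sub>E e) \<bullet> m = k *\<^sub>V e \<bullet> m" "e \<bullet> (k *\<^sub>U m) = k *\<^sub>V e \<bullet> m"
  "(e - e') \<bullet> m = e \<bullet> m - e' \<bullet> m" "e \<bullet> (m - m') = e \<bullet> m - e \<bullet> m'"
  "0 \<bullet> m = 0" "e \<bullet> 0 = 0"
  using UV.linear_add[OF linear_act_right] UV.linear_scale[OF linear_act_right]
    UV.linear_diff[OF linear_act_right] UV.linear_0[OF linear_act_right]
    EV.linear_add[OF linear_act_left] EV.linear_scale[OF linear_act_left]
    EV.linear_diff[OF linear_act_left] EV.linear_0[OF linear_act_left]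
  by auto

lemma faithfulD:
  assumes "\<And>m. e \<bullet> m = 0"
  shows "e = 0"
  using special assms unfolding special_def faithful_def annihilator_def by auto

lemma endomorphism_is_scalar:
  assumes "Vector_Spaces.linear (scale0 W) (scale0 W) f" "Vector_Spaces.linear (scale1 W) (scale1 W) g"
    and "\<And>e m. g (e \<bullet> m) = e \<bullet> f m"
  shows "\<exists>c. f = scale0 W c \<and> g = scale1 W c"
proof -
  have "(f, g) \<in> endomorphisms W" using assms by (simp add: endomorphisms_def)
  then show ?thesis using special unfolding special_def by auto
qed

text \<open>Both sides of the compatibility condition are bilinear in \<open>e\<close> and
  \<open>m\<close>, so nine products decide it. An explicit endomorphism then becomes a finite check
  against a table.\<close>

lemma endomorphism_on_basis:
  assumes bE: "basis_list sE [x, y, z]" and bU: "basis_list (scale0 W) [a, b, c]"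
    and f: "Vector_Spaces.linear (scale0 W) (scale0 W) f"
    and g: "Vector_Spaces.linear (scale1 W) (scale1 W) g"
    and eq: "\<And>e m. e \<in> {x, y, z} \<Longrightarrow> m \<in> {a, b, c} \<Longrightarrow> g (e \<bullet> m) = e \<bullet> f m"
  shows "\<exists>k. f = scale0 W k \<and> g = scale1 W k"
proof (rule endomorphism_is_scalar[OF f g])
  fix e m
  obtain p q r where e: "e = p *\<^sub>E x + q *\<^sub>E y + r *\<^sub>E z"
    using E.basis_list_tripleD(2)[OF bE] by blast
  obtain \<alpha> \<beta> \<gamma> where m: "m = \<alpha> *\<^sub>U a + \<beta> *\<^sub>U b + \<gamma> *\<^sub>U c"
    using U.basis_list_tripleD(2)[OF bU] by blast
  show "g (e \<bullet> m) = e \<bullet> f m"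
    unfolding e m
    by (simp add: UU.linear_add[OF f] UU.linear_scale[OF f] VV.linear_add[OF g] VV.linear_scale[OF g] eq
        V.scale_right_distrib)
qed

text \<open>If all products vanished, faithfulness would force \<open>E\<close> to be zero, against
  dimension 3.\<close>

lemma exists_act_nonzero: "\<exists>e m. e \<bullet> m \<noteq> 0"
proof (rule ccontr)
  assume "\<not> ?thesis"
  then have "(UNIV :: 'e set) \<subseteq> {0}" by (auto intro: faithfulD)
  then have "E.dim UNIV = 0" by (simp only: E.dim_eq_0)
  then show False using dim_E by linarith
qed

text \<open>If \<open>E w = 0\<close>, then \<open>\<langle>w\<rangle>\<close> is a direct summand, and a projection onto it is an endomorphism.\<close>

lemma act_nonzero:
  assumes "w \<noteq> 0"
  shows "\<exists>e. e \<bullet> w \<noteq> 0"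
proof (rule ccontr)
  assume "\<not> ?thesis"
  then have w: "\<And>e. e \<bullet> w = 0" by blast
  obtain b c where bU: "basis_list (scale0 W) [w, b, c]"
    using U.extend_basis_triple[OF dim_U assms] .
  obtain f where f: "Vector_Spaces.linear (scale0 W) (scale0 W) f" "f w = w" "f b = 0" "f c = 0"
    using UU.linear_extend_triple[OF bU] by blast
  have "e \<bullet> f m = 0" for e m
  proof -
    obtain \<alpha> \<beta> \<gamma> where m: "m = \<alpha> *\<^sub>U w + \<beta> *\<^sub>U b + \<gamma> *\<^sub>U c"
      using U.basis_list_tripleD(2)[OF bU] by blast
    show ?thesis unfolding m
      by (simp add: UU.linear_add[OF f(1)] UU.linear_scale[OF f(1)] f(2-) w)
  qed
  then obtain k where k: "f = scale0 W k" "(\<lambda>_. 0) = scale1 W k"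
    using endomorphism_is_scalar[OF f(1) VV.linear_zero] by auto
  obtain e m where em: "e \<bullet> m \<noteq> 0" using exists_act_nonzero by blast
  have "k *\<^sub>V e \<bullet> m = 0" using k(2) by metis
  then have "k = 0" using em by simp
  then have "f w = 0" using k by simp
  then show False using f assms by simp
qed

lemma submoduleI:
  assumes "U.subspace A" "V.subspace B" "\<And>e m. m \<in> A \<Longrightarrow> e \<bullet> m \<in> B"
  shows "submodule W (A, B)"
  using assms by (simp add: submodule_def)

lemma submoduleD:
  assumes "submodule W X"
  shows "U.subspace (fst X)" "V.subspace (snd X)" "m \<in> fst X \<Longrightarrow> e \<bullet> m \<in> snd X"
  using assms by (simp_all add: submodule_def)

lemma subspace_range_act: "V.subspace (range (\<lambda>e. e \<bullet> w))"
  using EV.linear_subspace_image[OF linear_act_left E.subspace_UNIV] .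

lemma submodule_generated: "submodule W (generated W w)"
  unfolding generated_def
proof (rule submoduleI)
  show "e \<bullet> m \<in> range (\<lambda>e. e \<bullet> w)" if "m \<in> U.span {w}" for e m
    using that V.subspace_scale[OF subspace_range_act] by (auto simp: U.span_singleton)
qed (simp_all add: subspace_range_act)


end

section \<open>Subbristles and bars\<close>

lemma subset_sumset:
  fixes A B :: "'a::ab_group_add set"
  assumes "0 \<in> A" "0 \<in> B"
  shows "A \<subseteq> {a + b |a b. a \<in> A \<and> b \<in> B}" "B \<subseteq> {a + b |a b. a \<in> A \<and> b \<in> B}"
proof -
  show "A \<subseteq> {a + b |a b. a \<in> A \<and> b \<in> B}"
    using assms(2) by (intro subsetI CollectI) (metis add_0_right)
  show "B \<subseteq> {a + b |a b. a \<in> A \<and> b \<in> B}"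
    using assms(1) by (intro subsetI CollectI) (metis add_0_left)
qed

context special_module
begin

text \<open>By \<open>act_nonzero\<close> the space \<open>Ew\<close> is exactly a line, so the
  composition series is 0 < (0, Ew) < (<w>, Ew). In a decomposition one summand contains
  \<open>w\<close>, hence also \<open>Ew\<close>, and nothing is left for the other.\<close>

lemma subbristle_generated:
  assumes "w \<noteq> 0" and line: "range (\<lambda>e. e \<bullet> w) \<subseteq> V.span {v}"
  shows "generated W w \<in> subbristles W"
proof -
  let ?L = "range (\<lambda>e. e \<bullet> w)"
  obtain e0 where e0: "e0 \<bullet> w \<noteq> 0" using act_nonzero[OF assms(1)] by blast
  then have L: "?L \<noteq> {0}" by (metis rangeI singletonD)
  have cases0: "S = {0} \<or> S = U.span {w}" if "U.subspace S" "S \<subseteq> U.span {w}" for S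
    using U.subspace_singleton_cases that by blast
  have cases1: "S = {0} \<or> S = ?L" if "V.subspace S" "S \<subseteq> ?L" for S
    using V.subspace_singleton_cases[OF that(1)] V.subspace_singleton_cases[OF subspace_range_act line]
      that(2) L line by blast
  have gen: "generated W w = (U.span {w}, ?L)" by (simp add: generated_def)
  have w: "w \<in> U.span {w}" by (simp add: U.span_base)
  then have spw: "U.span {w} \<noteq> {0}" using assms by auto
  have indec: "indecomposable W (generated W w)"
    unfolding indecomposable_def
  proof (intro conjI allI impI)
    show "generated W w \<noteq> zero_sub" using L by (auto simp: gen zero_sub_def)
  next
    \<comment> \<open>Stated for arbitrary \<open>A\<close> and \<open>B\<close> because it is
      applied with the two summands in either order.\<close>
    have aux: "B = zero_sub"
      if A: "submodule W A" and B: "submodule W B" and "fst A = U.span {w}"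
        and "fst B \<subseteq> U.span {w}" "snd B \<subseteq> ?L" "fst A \<inter> fst B = {0}" "snd A \<inter> snd B = {0}" for A B
    proof -
      have "?L \<subseteq> snd A" using submoduleD(3)[OF A] that(3) w by auto
      then have "fst B \<subseteq> fst A" "snd B \<subseteq> snd A" using that(3-5) by auto
      then have "fst B = {0}" "snd B = {0}" using that(6,7) by (simp_all add: Int_absorb1)
      then show ?thesis by (simp add: zero_sub_def prod_eq_iff)
    qed
    fix A B assume A: "submodule W A" and B: "submodule W B" and s: "direct_sum_of (generated W w) A B"
    note sA = submoduleD(1,2)[OF A] and sB = submoduleD(1,2)[OF B]
    have fs: "U.span {w} = {a + b |a b. a \<in> fst A \<and> b \<in> fst B}"
      and ss: "?L = {a + b |a b. a \<in> snd A \<and> b \<in> snd B}"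
      and i: "fst A \<inter> fst B = {0}" "snd A \<inter> snd B = {0}"
      using s by (simp_all add: direct_sum_of_def gen)
    have subs: "fst A \<subseteq> U.span {w}" "fst B \<subseteq> U.span {w}" "snd A \<subseteq> ?L" "snd B \<subseteq> ?L"
      using subset_sumset[OF U.subspace_0[OF sA(1)] U.subspace_0[OF sB(1)]]
        subset_sumset[OF V.subspace_0[OF sA(2)] V.subspace_0[OF sB(2)]]
      unfolding fs ss by simp_all
    have "fst A = U.span {w} \<or> fst B = U.span {w}"
    proof (rule ccontr)
      assume "\<not> ?thesis"
      then have "fst A = {0}" "fst B = {0}"
        using cases0[OF sA(1) subs(1)] cases0[OF sB(1) subs(2)] by blast+
      then show False using fs spw by simp
    qed
    then show "A = zero_sub \<or> B = zero_sub"
      using aux[OF A B _ subs(2,4) i] aux[OF B A _ subs(1,3)] i by (auto simp: Int_commute)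
  qed
  \<comment> \<open>Only the indices 0, 1, 2 matter; the value is constant from 2 on so that every
    \<open>C i\<close> is a submodule.\<close>
  define C where "C i = (if i = 0 then zero_sub else if i = 1 then ({0}, ?L) else generated W w)" for i :: nat
  have sub: "submodule W (C i)" for i
    unfolding C_def using submodule_generated V.subspace_0[OF subspace_range_act, of w]
    by (auto simp: zero_sub_def intro!: submoduleI subspace_range_act)
  moreover have "C 0 < C 1" "C 1 < C 2"
    using L spw V.subspace_0[OF subspace_range_act, of w] U.span_zero[of "{w}"]
    by (auto simp: C_def zero_sub_def gen less_le less_eq_prod_def)
  moreover have "\<not> (\<exists>X. submodule W X \<and> C 0 < X \<and> X < C 1)"
  proof safe
    fix X assume X: "submodule W X" "C 0 < X" "X < C 1"
    then have "fst X \<subseteq> {0}" "snd X \<subseteq> ?L" "X \<noteq> zero_sub" "X \<noteq> ({0}, ?L)"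
      by (auto simp: C_def less_le less_eq_prod_def)
    moreover have "fst X = {0}" using calculation(1) U.subspace_0[OF submoduleD(1)[OF X(1)]] by auto
    ultimately show False
      using cases1[OF submoduleD(2)[OF X(1)]] by (auto simp: zero_sub_def prod_eq_iff)
  qed
  moreover have "\<not> (\<exists>X. submodule W X \<and> C 1 < X \<and> X < C 2)"
  proof safe
    fix X assume X: "submodule W X" "C 1 < X" "X < C 2"
    then have "fst X \<subseteq> U.span {w}" "snd X = ?L" "X \<noteq> ({0}, ?L)" "X \<noteq> (U.span {w}, ?L)"
      by (auto simp: C_def less_le less_eq_prod_def gen)
    then show False
      using cases0[OF submoduleD(1)[OF X(1)]] by (auto simp: prod_eq_iff)
  qed
  ultimately have "C i < C (Suc i) \<and> \<not> (\<exists>X. submodule W X \<and> C i < X \<and> X < C (Suc i))" if "i < 2" for i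
    using less_2_cases[OF that] by (elim disjE) (simp_all only: One_nat_def numeral_2_eq_2 simp_thms)
  moreover have "C 2 = generated W w" "C 0 = zero_sub" by (simp_all add: C_def)
  ultimately have "has_length W (generated W w) 2"
    unfolding has_length_def using sub by (intro exI[of _ C]) simp
  then show ?thesis
    using indec submodule_generated by (simp add: subbristles_def)
qed

text \<open>The middle term \<open>Y\<close> of a composition series is simple. It lives at vertex
  1, because a nonzero vector at vertex 0 is never killed by all of \<open>E\<close>.
  Indecomposability forbids that all of \<open>X\<close> lives there, and maximality of
  \<open>Y\<close> in \<open>X\<close> leaves just one dimension at each vertex.\<close>

lemma subbristleD:
  assumes "X \<in> subbristles W"
  shows "\<exists>w v. w \<noteq> 0 \<and> range (\<lambda>e. e \<bullet> w) \<subseteq> V.span {v} \<and> X = generated W w"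
proof -
  have X: "submodule W X" and ind: "indecomposable W X" and len: "has_length W X 2"
    using assms by (auto simp: subbristles_def)
  note sX = submoduleD[OF X]
  obtain C where C: "C 0 = zero_sub" "C (2::nat) = X" "\<forall>i\<le>2. submodule W (C i)"
    and steps: "\<forall>i<2. C i < C (Suc i) \<and> \<not> (\<exists>Y. submodule W Y \<and> C i < Y \<and> Y < C (Suc i))"
    using len unfolding has_length_def by blast
  define Y where "Y = C 1"
  have Y: "submodule W Y" "zero_sub < Y" "Y < X"
    and min: "\<And>Z. submodule W Z \<Longrightarrow> zero_sub < Z \<Longrightarrow> \<not> Z < Y"
    and max: "\<And>Z. submodule W Z \<Longrightarrow> Y < Z \<Longrightarrow> \<not> Z < X"
    using C steps[rule_format, of 0] steps[rule_format, of 1] unfolding Y_def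
    by (auto simp: numeral_2_eq_2)
  note sY = submoduleD[OF Y(1)]
  have vert: "submodule W ({0}, S)" if "V.subspace S" for S
    using that V.subspace_0 by (intro submoduleI) auto
  have "fst Y = {0}"
  proof (rule ccontr)
    assume *: "fst Y \<noteq> {0}"
    then obtain w where w: "w \<in> fst Y" "w \<noteq> 0" using U.subspace_0[OF sY(1)] by auto
    obtain e where "e \<bullet> w \<noteq> 0" using act_nonzero[OF w(2)] by blast
    then have "snd Y \<noteq> {0}" using sY(3)[OF w(1)] by fastforce
    \<comment> \<open>Dropping the component at vertex 0 yields a submodule strictly between zero
      and the simple \<open>Y\<close>.\<close>
    then have "zero_sub < ({0}, snd Y)" "({0}, snd Y) < Y"
      using * U.subspace_0[OF sY(1)] V.subspace_0[OF sY(2)]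
      by (auto simp: zero_sub_def less_le less_eq_prod_def prod_eq_iff)
    then show False using min vert[OF sY(2)] by blast
  qed
  then obtain v where v: "v \<in> snd Y" "v \<noteq> 0"
    using Y(2) V.subspace_0[OF sY(2)] by (auto simp: zero_sub_def less_le less_eq_prod_def prod_eq_iff)
  have "({0}, V.span {v}) \<le> Y"
    using v(1) sY(2) \<open>fst Y = {0}\<close> V.span_minimal[of "{v}" "snd Y"] by (simp add: less_eq_prod_def)
  moreover have "zero_sub < ({0} :: 'u set, V.span {v})"
    using v(2) V.span_base[of v "{v}"] V.span_zero[of "{v}"] by (auto simp: zero_sub_def less_le less_eq_prod_def)
  ultimately have Yv: "Y = ({0}, V.span {v})"
    using min vert[OF V.subspace_span] by (metis less_le)
  have "fst X \<noteq> {0}"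
  proof
    assume 0: "fst X = {0}"
    have "v \<in> snd X" using v Y(3) by (auto simp: less_le less_eq_prod_def)
    then obtain T where T: "V.subspace T" "snd X = {a + b |a b. a \<in> V.span {v} \<and> b \<in> T}" "V.span {v} \<inter> T = {0}"
      using V.subspace_complement_span_singleton[OF sX(2)] by blast
    \<comment> \<open>A module concentrated at vertex 1 splits along any complement of the line, so
      indecomposability makes it equal to \<open>Y\<close>.\<close>
    have "direct_sum_of X ({0}, V.span {v}) ({0}, T)"
      unfolding direct_sum_of_def using 0 T by simp
    then have "({0} :: 'u set, V.span {v}) = zero_sub \<or> ({0} :: 'u set, T) = zero_sub"
      using conjunct2[OF ind[unfolded indecomposable_def], rule_format, OF vert[OF V.subspace_span[of "{v}"]] vert[OF T(1)]]
      by auto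
    then have "T = {0}" using \<open>zero_sub < ({0} :: 'u set, V.span {v})\<close> less_irrefl
      unfolding zero_sub_def by (metis prod.inject)
    then have "X = Y" using T(2) 0 Yv by (simp add: prod_eq_iff)
    then show False using Y(3) by simp
  qed
  then obtain w where w: "w \<in> fst X" "w \<noteq> 0" using U.subspace_0[OF sX(1)] by auto
  \<comment> \<open>Nothing lies strictly between \<open>Y\<close> and \<open>X\<close>, so this
    proper submodule of \<open>X\<close> must be \<open>Y\<close> itself.\<close>
  have "Y \<le> ({0}, snd X)" "({0}, snd X) < X"
    using \<open>fst X \<noteq> {0}\<close> Yv Y(3) U.subspace_0[OF sX(1)] by (auto simp: less_le less_eq_prod_def prod_eq_iff)
  then have sndX: "snd X = V.span {v}"
    using max[OF vert[OF sX(2)]] Yv by (auto simp: less_le)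
  have "submodule W (U.span {w}, snd X)"
    using sX w(1) U.span_minimal[of "{w}" "fst X"] by (intro submoduleI) auto
  moreover have "Y < (U.span {w}, snd X)"
    using w Yv sndX U.span_base[of w "{w}"] U.span_zero[of "{w}"] by (auto simp: less_le less_eq_prod_def)
  moreover have "(U.span {w}, snd X) \<le> X"
    using w(1) sX(1) U.span_minimal[of "{w}" "fst X"] by (simp add: less_eq_prod_def)
  ultimately have fstX: "X = (U.span {w}, snd X)"
    using max by (metis less_le)
  have line: "range (\<lambda>e. e \<bullet> w) \<subseteq> V.span {v}"
    using sX(3)[OF w(1)] sndX by auto
  moreover have "range (\<lambda>e. e \<bullet> w) \<noteq> {0}"
    using act_nonzero[OF w(2)] by (metis rangeI singletonD)
  ultimately have "range (\<lambda>e. e \<bullet> w) = V.span {v}"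
    using V.subspace_singleton_cases[OF subspace_range_act] by blast
  then have "X = generated W w" using fstX sndX by (simp add: generated_def)
  then show ?thesis using w(2) line by blast
qed

text \<open>Some nonzero \<open>e\<close> kills the plane \<open>fst X\<close> but, \<open>W\<close>
  being faithful, not the whole space. So the plane is the entire kernel of \<open>e\<close>, and
  \<open>e\<close> has rank one: bars are found by searching for such elements of
  \<open>E\<close>.\<close>

lemma barD:
  assumes "X \<in> bars W"
  shows "\<exists>e v. e \<noteq> 0 \<and> range (\<lambda>m. e \<bullet> m) \<subseteq> V.span {v} \<and> X = ({m. e \<bullet> m = 0}, UNIV)"
proof -
  have X: "submodule W X" and d: "U.dim (fst X) = 2" "V.dim (snd X) = 2" and nf: "\<not> faithful W X"
    using assms by (auto simp: bars_def dim_vector_def)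
  note sX = submoduleD[OF X]
  have sndX: "snd X = UNIV"
    using V.subspace_dim_equal[OF sX(2) V.subspace_UNIV] d(2) dim_V by simp
  have "0 \<in> annihilator W X" by (simp add: annihilator_def)
  then obtain e where e: "e \<noteq> 0" "\<And>m. m \<in> fst X \<Longrightarrow> e \<bullet> m = 0"
    using nf unfolding faithful_def annihilator_def by blast
  obtain m0 where m0: "e \<bullet> m0 \<noteq> 0" using faithfulD e(1) by blast
  then have "m0 \<notin> fst X" using e(2) by blast
  \<comment> \<open>A vector outside the plane completes it to the 3-dimensional space, so
    \<open>e\<close> is determined by its value at \<open>m0\<close>.\<close>
  then have "U.dim (insert m0 (fst X)) = U.dim UNIV"
    using d(1) dim_U sX(1) U.span_eq_iff[of "fst X"] by (simp add: U.dim_insert del: U.dim_UNIV U.span_eq_iff)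
  then have sp: "U.span (insert m0 (fst X)) = UNIV"
    using U.dim_eq_span[of "insert m0 (fst X)" UNIV] by (simp del: U.dim_UNIV)
  have dec: "\<exists>k. m - k *\<^sub>U m0 \<in> fst X" for m
    using U.span_breakdown_eq[of m m0 "fst X"] sp iffD2[OF U.span_eq_iff sX(1)] by simp
  have act: "e \<bullet> m = k *\<^sub>V e \<bullet> m0" if "m - k *\<^sub>U m0 \<in> fst X" for m k
    using e(2)[OF that] by simp
  have "range (\<lambda>m. e \<bullet> m) \<subseteq> V.span {e \<bullet> m0}"
    using dec act by (force simp: V.span_singleton)
  moreover have "fst X = {m. e \<bullet> m = 0}"
  proof (intro subset_antisym subsetI; clarsimp simp: e(2))
    fix m assume m: "e \<bullet> m = 0"
    obtain k where k: "m - k *\<^sub>U m0 \<in> fst X" using dec by blast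
    with act m m0 have "k = 0" by (metis V.scale_eq_0_iff)
    with k show "m \<in> fst X" by simp
  qed
  ultimately show ?thesis using e(1) sndX by (metis prod.collapse)
qed

lemma barI:
  assumes "a \<noteq> b" "U.independent {a, b}" "e \<noteq> 0" "e \<bullet> a = 0" "e \<bullet> b = 0"
  shows "(U.span {a, b}, UNIV) \<in> bars W"
proof -
  have "e \<in> annihilator W (U.span {a, b}, UNIV)"
    using assms by (auto simp: annihilator_def U.in_span_pair_iff)
  then have "\<not> faithful W (U.span {a, b}, UNIV)"
    using assms(3) by (auto simp: faithful_def)
  moreover have "U.dim (U.span {a, b}) = 2"
    using U.dim_span_eq_card_independent[OF assms(2)] assms(1) by simp
  ultimately show ?thesis
    using dim_V by (simp add: bars_def dim_vector_def submoduleI del: V.dim_UNIV)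
qed

text \<open>This is the vanishing of a 2 x 2 minor. The map \<open>f\<close> is abstract because it
  is instantiated both by the action on a fixed \<open>w\<close> (subbristles) and by the action of
  a fixed element of \<open>E\<close> (bars).\<close>

lemma in_line_proportional:
  assumes bV: "basis_list (scale1 W) [d, e]" and line: "range f \<subseteq> V.span {v}"
    and f: "f i = p *\<^sub>V d + q *\<^sub>V e" "f j = p' *\<^sub>V d + q' *\<^sub>V e"
  shows "p * q' = p' * q"
proof -
  obtain s t where v: "v = s *\<^sub>V d + t *\<^sub>V e"
    using V.basis_list_pairD(2)[OF bV] by blast
  have *: "\<exists>k. p = k * s \<and> q = k * t" if fi: "f i = p *\<^sub>V d + q *\<^sub>V e" for i p q
  proof -
    have "p *\<^sub>V d + q *\<^sub>V e \<in> V.span {v}" using line unfolding fi[symmetric] by blast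
    then obtain k where "p *\<^sub>V d + q *\<^sub>V e = k *\<^sub>V v" by (auto simp: V.span_singleton)
    then have "p *\<^sub>V d + q *\<^sub>V e = (k * s) *\<^sub>V d + (k * t) *\<^sub>V e"
      by (simp add: v V.scale_right_distrib)
    then show ?thesis unfolding V.basis_list_pairD(1)[OF bV] by blast
  qed
  show ?thesis using *[OF f(1)] *[OF f(2)] by auto
qed

lemma basis_list_V_nonzero:
  assumes "basis_list (scale1 W) [d, e]"
  shows "p *\<^sub>V d + q *\<^sub>V e = 0 \<longleftrightarrow> p = 0 \<and> q = 0" "d \<noteq> 0" "e \<noteq> 0" "d + e \<noteq> 0"
proof -
  show *: "p *\<^sub>V d + q *\<^sub>V e = 0 \<longleftrightarrow> p = 0 \<and> q = 0" for p q
    using V.basis_list_pairD(1)[OF assms, of p q 0 0] by simp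
  show "d \<noteq> 0" "e \<noteq> 0" "d + e \<noteq> 0" using *[of 1 0] *[of 0 1] *[of 1 1] by auto
qed

lemma generated_scale:
  assumes "k \<noteq> 0"
  shows "generated W (k *\<^sub>U w) = generated W w"
proof -
  have "U.span {k *\<^sub>U w} = U.span {w}"
    using assms U.span_image_scale[of "{w}" "\<lambda>_. k"] by simp
  moreover have "range (\<lambda>e. e \<bullet> (k *\<^sub>U w)) = range (\<lambda>e. e \<bullet> w)"
  proof safe
    fix e
    have "e \<bullet> (k *\<^sub>U w) = (k *\<^sub>E e) \<bullet> w" by simp
    then show "e \<bullet> (k *\<^sub>U w) \<in> range (\<lambda>e. e \<bullet> w)" by blast
    have "e \<bullet> w = (inverse k *\<^sub>E e) \<bullet> (k *\<^sub>U w)" using assms by simp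
    then show "e \<bullet> w \<in> range (\<lambda>e. e \<bullet> (k *\<^sub>U w))" by blast
  qed
  ultimately show ?thesis by (simp add: generated_def)
qed

lemma generated_eqD:
  assumes "generated W w = generated W w'"
  shows "\<exists>k. w = k *\<^sub>U w'"
proof -
  have "w \<in> U.span {w'}"
    using assms U.span_base[of w "{w}"] by (simp add: generated_def)
  then show ?thesis by (auto simp: U.span_singleton)
qed

lemma annihilator_span_pair:
  "annihilator W (U.span {a, b}, UNIV) = {e. e \<bullet> a = 0 \<and> e \<bullet> b = 0}"
proof -
  have "a \<in> U.span {a, b}" "b \<in> U.span {a, b}" by (simp_all add: U.span_base)
  then show ?thesis by (auto simp: annihilator_def U.in_span_pair_iff)
qed

lemma range_act_in_line:
  assumes "basis_list sE [x, y, z]"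
    and "x \<bullet> w \<in> V.span {v}" "y \<bullet> w \<in> V.span {v}" "z \<bullet> w \<in> V.span {v}"
  shows "range (\<lambda>e. e \<bullet> w) \<subseteq> V.span {v}"
proof (rule image_subsetI)
  fix e
  obtain p q r where "e = p *\<^sub>E x + q *\<^sub>E y + r *\<^sub>E z"
    using E.basis_list_tripleD(2)[OF assms(1)] by blast
  then show "e \<bullet> w \<in> V.span {v}" using assms(2-4) by (simp add: V.span_add V.span_scale)
qed

lemma kernel_eq_span_pair:
  assumes bU: "basis_list (scale0 W) [a, b, c]" and e: "e \<bullet> a = 0" "e \<bullet> b = 0" "e \<bullet> c \<noteq> 0"
  shows "{m. e \<bullet> m = 0} = U.span {a, b}"
proof (intro subset_antisym subsetI)
  fix m assume "m \<in> {m. e \<bullet> m = 0}"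
  moreover obtain \<alpha> \<beta> \<gamma> where m: "m = \<alpha> *\<^sub>U a + \<beta> *\<^sub>U b + \<gamma> *\<^sub>U c"
    using U.basis_list_tripleD(2)[OF bU] by blast
  ultimately have "\<gamma> = 0" using e by simp
  then show "m \<in> U.span {a, b}" unfolding U.in_span_pair_iff m by auto
qed (auto simp: U.in_span_pair_iff e)

lemma generated_neq:
  assumes "a \<noteq> c" "U.independent {a, c}"
  shows "generated W a \<noteq> generated W c"
proof
  assume "generated W a = generated W c"
  then obtain k where "a = k *\<^sub>U c" using generated_eqD by blast
  then have "1 *\<^sub>U a + (- k) *\<^sub>U c = 0" by simp
  moreover have "\<forall>\<alpha> \<beta>. \<alpha> *\<^sub>U a + \<beta> *\<^sub>U c = 0 \<longrightarrow> \<alpha> = 0 \<and> \<beta> = 0"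
    using U.independent_pair_iff[of a c] assms by simp
  ultimately show False by (metis zero_neq_one)
qed

section \<open>Subbristles, bars and annihilators for each of the four tables\<close>

lemma table_type_1:
  assumes bV: "basis_list (scale1 W) [d, e]"
    and table: "x \<bullet> a = d" "x \<bullet> b = e" "x \<bullet> c = 0"
      "y \<bullet> a = 0" "y \<bullet> b = d" "y \<bullet> c = e"
      "z \<bullet> a = 0" "z \<bullet> b = 0" "z \<bullet> c = d"
  shows "basis_list sE [x, y, z]" "basis_list (scale0 W) [a, b, c]"
    "subbristles W = {generated W a}"
    "bars W = {(U.span {a, b}, UNIV)}"
    "annihilator W (U.span {a, b}, UNIV) = E.span {z}"
    "bristle_type W = 1"
proof -
  note nz = basis_list_V_nonzero[OF bV]
  have actw: "x \<bullet> (\<alpha> *\<^sub>U a + \<beta> *\<^sub>U b + \<gamma> *\<^sub>U c) = \<alpha> *\<^sub>V d + \<beta> *\<^sub>V e"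
    "y \<bullet> (\<alpha> *\<^sub>U a + \<beta> *\<^sub>U b + \<gamma> *\<^sub>U c) = \<beta> *\<^sub>V d + \<gamma> *\<^sub>V e"
    "z \<bullet> (\<alpha> *\<^sub>U a + \<beta> *\<^sub>U b + \<gamma> *\<^sub>U c) = \<gamma> *\<^sub>V d + 0 *\<^sub>V e" for \<alpha> \<beta> \<gamma>
    by (simp_all add: table V.scale_right_distrib V.scale_left_distrib ac_simps)
  have acte: "(p *\<^sub>E x + q *\<^sub>E y + r *\<^sub>E z) \<bullet> a = p *\<^sub>V d + 0 *\<^sub>V e"
    "(p *\<^sub>E x + q *\<^sub>E y + r *\<^sub>E z) \<bullet> b = q *\<^sub>V d + p *\<^sub>V e"
    "(p *\<^sub>E x + q *\<^sub>E y + r *\<^sub>E z) \<bullet> c = r *\<^sub>V d + q *\<^sub>V e" for p q r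
    by (simp_all add: table V.scale_right_distrib V.scale_left_distrib ac_simps)
  \<comment> \<open>Evaluating a linear relation at \<open>a\<close>, \<open>b\<close>,
    \<open>c\<close> and comparing coefficients at \<open>d\<close> and \<open>e\<close> makes it
    trivial; the dimension does the rest. This is why the bases are conclusions and not
    hypotheses.\<close>
  show bE: "basis_list sE [x, y, z]"
  proof (rule E.basis_list_tripleI[OF dim_E])
    fix p q r assume *: "p *\<^sub>E x + q *\<^sub>E y + r *\<^sub>E z = 0"
    show "p = 0 \<and> q = 0 \<and> r = 0"
      using acte[of p q r] nz unfolding * by (simp add: eq_commute[of 0])
  qed
  show bU: "basis_list (scale0 W) [a, b, c]"
  proof (rule U.basis_list_tripleI[OF dim_U])
    fix \<alpha> \<beta> \<gamma> assume *: "\<alpha> *\<^sub>U a + \<beta> *\<^sub>U b + \<gamma> *\<^sub>U c = 0"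
    show "\<alpha> = 0 \<and> \<beta> = 0 \<and> \<gamma> = 0"
      using actw[of \<alpha> \<beta> \<gamma>] nz unfolding * by (simp add: eq_commute[of 0])
  qed
  note ind = U.basis_list_triple_independent[OF bU] and indE = E.basis_list_triple_independent[OF bE]
  \<comment> \<open>The minors are \<alpha>\<gamma> - \<beta>\<beta>, \<beta>\<gamma> and
    \<gamma>\<gamma> up to sign, so \<gamma> vanishes first and then \<beta>.\<close>
  have subD: "\<beta> = 0 \<and> \<gamma> = 0"
    if "range (\<lambda>e. e \<bullet> (\<alpha> *\<^sub>U a + \<beta> *\<^sub>U b + \<gamma> *\<^sub>U c)) \<subseteq> V.span {v}" for \<alpha> \<beta> \<gamma> v
    using in_line_proportional[OF bV that actw(1,2)] in_line_proportional[OF bV that actw(1,3)]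
      in_line_proportional[OF bV that actw(2,3)]
    by auto
  \<comment> \<open>The minors are pp, pq and qq - pr up to sign.\<close>
  have barD': "p = 0 \<and> q = 0"
    if "range (\<lambda>m. (p *\<^sub>E x + q *\<^sub>E y + r *\<^sub>E z) \<bullet> m) \<subseteq> V.span {v}" for p q r v
    using in_line_proportional[OF bV that acte(1,2)] in_line_proportional[OF bV that acte(1,3)]
      in_line_proportional[OF bV that acte(2,3)]
    by auto
  have sub: "generated W a \<in> subbristles W"
    using subbristle_generated[OF ind(7) range_act_in_line[OF bE, of a "d"]]
    by (simp_all add: table V.span_base V.span_zero)
  show subs: "subbristles W = {generated W a}"
  proof (intro subset_antisym subsetI)
    fix X assume "X \<in> subbristles W"
    then obtain w v where w: "w \<noteq> 0" "range (\<lambda>e. e \<bullet> w) \<subseteq> V.span {v}" "X = generated W w"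
      using subbristleD by blast
    obtain \<alpha> \<beta> \<gamma> where ww: "w = \<alpha> *\<^sub>U a + \<beta> *\<^sub>U b + \<gamma> *\<^sub>U c"
      using U.basis_list_tripleD(2)[OF bU] by blast
    show "X \<in> {generated W a}"
      using subD[OF w(2)[unfolded ww]] w(1) generated_scale unfolding w(3) ww by auto
  qed (use sub in auto)
  show "bristle_type W = 1" by (simp add: bristle_type_def subs one_enat_def)
  have bars: "(U.span {a, b}, UNIV) \<in> bars W"
    using barI[OF ind(1,4) indE(9)] by (simp_all add: table)
  show "bars W = {(U.span {a, b}, UNIV)}"
  proof (intro subset_antisym subsetI)
    fix X assume "X \<in> bars W"
    then obtain e' v where e': "e' \<noteq> 0" "range (\<lambda>m. e' \<bullet> m) \<subseteq> V.span {v}" "X = ({m. e' \<bullet> m = 0}, UNIV)"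
      using barD by blast
    obtain p q r where ee: "e' = p *\<^sub>E x + q *\<^sub>E y + r *\<^sub>E z"
      using E.basis_list_tripleD(2)[OF bE] by blast
    have cases: "(p = 0 \<and> q = 0 \<and> r \<noteq> 0)"
      using barD'[OF e'(2)[unfolded ee]] e'(1) unfolding ee by auto
    have ker_ab: "{m. e' \<bullet> m = 0} = U.span {a, b}" if "p = 0 \<and> q = 0 \<and> r \<noteq> 0"
      by (rule kernel_eq_span_pair[OF bU]; unfold ee acte; use that nz in auto)
    show "X \<in> {(U.span {a, b}, UNIV)}"
      using cases ker_ab unfolding e'(3) by auto
  qed (use bars in auto)
  show "annihilator W (U.span {a, b}, UNIV) = E.span {z}"
  proof (intro subset_antisym subsetI)
    fix e' assume "e' \<in> annihilator W (U.span {a, b}, UNIV)"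
    moreover obtain p q r where ee: "e' = p *\<^sub>E x + q *\<^sub>E y + r *\<^sub>E z"
      using E.basis_list_tripleD(2)[OF bE] by blast
    ultimately show "e' \<in> E.span {z}"
      using nz acte[of p q r] unfolding annihilator_span_pair
      by (auto simp: E.span_scale E.span_base)
  qed (auto simp: annihilator_span_pair table E.span_singleton)
qed

lemma table_type_2:
  assumes bV: "basis_list (scale1 W) [d, e]"
    and table: "x \<bullet> a = d" "x \<bullet> b = e" "x \<bullet> c = 0"
      "y \<bullet> a = 0" "y \<bullet> b = d" "y \<bullet> c = 0"
      "z \<bullet> a = 0" "z \<bullet> b = 0" "z \<bullet> c = e"
  shows "basis_list sE [x, y, z]" "basis_list (scale0 W) [a, b, c]"
    "subbristles W = {generated W a, generated W c}"
    "bars W = {(U.span {a, b}, UNIV), (U.span {a, c}, UNIV)}"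
    "annihilator W (U.span {a, b}, UNIV) = E.span {z}"
    "annihilator W (U.span {a, c}, UNIV) = E.span {y}"
    "bristle_type W = 2"
proof -
  note nz = basis_list_V_nonzero[OF bV]
  have actw: "x \<bullet> (\<alpha> *\<^sub>U a + \<beta> *\<^sub>U b + \<gamma> *\<^sub>U c) = \<alpha> *\<^sub>V d + \<beta> *\<^sub>V e"
    "y \<bullet> (\<alpha> *\<^sub>U a + \<beta> *\<^sub>U b + \<gamma> *\<^sub>U c) = \<beta> *\<^sub>V d + 0 *\<^sub>V e"
    "z \<bullet> (\<alpha> *\<^sub>U a + \<beta> *\<^sub>U b + \<gamma> *\<^sub>U c) = 0 *\<^sub>V d + \<gamma> *\<^sub>V e" for \<alpha> \<beta> \<gamma>
    by (simp_all add: table V.scale_right_distrib V.scale_left_distrib ac_simps)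
  have acte: "(p *\<^sub>E x + q *\<^sub>E y + r *\<^sub>E z) \<bullet> a = p *\<^sub>V d + 0 *\<^sub>V e"
    "(p *\<^sub>E x + q *\<^sub>E y + r *\<^sub>E z) \<bullet> b = q *\<^sub>V d + p *\<^sub>V e"
    "(p *\<^sub>E x + q *\<^sub>E y + r *\<^sub>E z) \<bullet> c = 0 *\<^sub>V d + r *\<^sub>V e" for p q r
    by (simp_all add: table V.scale_right_distrib V.scale_left_distrib ac_simps)
  show bE: "basis_list sE [x, y, z]"
  proof (rule E.basis_list_tripleI[OF dim_E])
    fix p q r assume *: "p *\<^sub>E x + q *\<^sub>E y + r *\<^sub>E z = 0"
    show "p = 0 \<and> q = 0 \<and> r = 0"
      using acte[of p q r] nz unfolding * by (simp add: eq_commute[of 0])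
  qed
  show bU: "basis_list (scale0 W) [a, b, c]"
  proof (rule U.basis_list_tripleI[OF dim_U])
    fix \<alpha> \<beta> \<gamma> assume *: "\<alpha> *\<^sub>U a + \<beta> *\<^sub>U b + \<gamma> *\<^sub>U c = 0"
    show "\<alpha> = 0 \<and> \<beta> = 0 \<and> \<gamma> = 0"
      using actw[of \<alpha> \<beta> \<gamma>] nz unfolding * by (simp add: eq_commute[of 0])
  qed
  note ind = U.basis_list_triple_independent[OF bU] and indE = E.basis_list_triple_independent[OF bE]
  \<comment> \<open>The minors are \<beta>\<beta>, \<alpha>\<gamma> and \<beta>\<gamma> up to
    sign.\<close>
  have subD: "\<beta> = 0 \<and> (\<alpha> = 0 \<or> \<gamma> = 0)"
    if "range (\<lambda>e. e \<bullet> (\<alpha> *\<^sub>U a + \<beta> *\<^sub>U b + \<gamma> *\<^sub>U c)) \<subseteq> V.span {v}" for \<alpha> \<beta> \<gamma> v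
    using in_line_proportional[OF bV that actw(1,2)] in_line_proportional[OF bV that actw(1,3)]
      in_line_proportional[OF bV that actw(2,3)]
    by auto
  \<comment> \<open>The minors are pp, pr and qr up to sign.\<close>
  have barD': "p = 0 \<and> (q = 0 \<or> r = 0)"
    if "range (\<lambda>m. (p *\<^sub>E x + q *\<^sub>E y + r *\<^sub>E z) \<bullet> m) \<subseteq> V.span {v}" for p q r v
    using in_line_proportional[OF bV that acte(1,2)] in_line_proportional[OF bV that acte(1,3)]
      in_line_proportional[OF bV that acte(2,3)]
    by auto
  have sub: "generated W a \<in> subbristles W" "generated W c \<in> subbristles W"
    using subbristle_generated[OF ind(7) range_act_in_line[OF bE, of a "d"]]
      subbristle_generated[OF ind(9) range_act_in_line[OF bE, of c "e"]]
    by (simp_all add: table V.span_base V.span_zero)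
  show subs: "subbristles W = {generated W a, generated W c}"
  proof (intro subset_antisym subsetI)
    fix X assume "X \<in> subbristles W"
    then obtain w v where w: "w \<noteq> 0" "range (\<lambda>e. e \<bullet> w) \<subseteq> V.span {v}" "X = generated W w"
      using subbristleD by blast
    obtain \<alpha> \<beta> \<gamma> where ww: "w = \<alpha> *\<^sub>U a + \<beta> *\<^sub>U b + \<gamma> *\<^sub>U c"
      using U.basis_list_tripleD(2)[OF bU] by blast
    show "X \<in> {generated W a, generated W c}"
      using subD[OF w(2)[unfolded ww]] w(1) generated_scale unfolding w(3) ww by auto
  qed (use sub in auto)
  show "bristle_type W = 2"
    using generated_neq[OF ind(2,5)] by (simp add: bristle_type_def subs numeral_eq_enat)
  have bars: "(U.span {a, b}, UNIV) \<in> bars W" "(U.span {a, c}, UNIV) \<in> bars W"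
    using barI[OF ind(1,4) indE(9)]
      barI[OF ind(2,5) indE(8)] by (simp_all add: table)
  have bU_ac: "basis_list (scale0 W) [a, c, b]"
    using bU by (auto simp: basis_list_def insert_commute)
  show "bars W = {(U.span {a, b}, UNIV), (U.span {a, c}, UNIV)}"
  proof (intro subset_antisym subsetI)
    fix X assume "X \<in> bars W"
    then obtain e' v where e': "e' \<noteq> 0" "range (\<lambda>m. e' \<bullet> m) \<subseteq> V.span {v}" "X = ({m. e' \<bullet> m = 0}, UNIV)"
      using barD by blast
    obtain p q r where ee: "e' = p *\<^sub>E x + q *\<^sub>E y + r *\<^sub>E z"
      using E.basis_list_tripleD(2)[OF bE] by blast
    have cases: "(p = 0 \<and> q = 0 \<and> r \<noteq> 0) \<or> (p = 0 \<and> r = 0 \<and> q \<noteq> 0)"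
      using barD'[OF e'(2)[unfolded ee]] e'(1) unfolding ee by auto
    have ker_ab: "{m. e' \<bullet> m = 0} = U.span {a, b}" if "p = 0 \<and> q = 0 \<and> r \<noteq> 0"
      by (rule kernel_eq_span_pair[OF bU]; unfold ee acte; use that nz in auto)
    have ker_ac: "{m. e' \<bullet> m = 0} = U.span {a, c}" if "p = 0 \<and> r = 0 \<and> q \<noteq> 0"
      by (rule kernel_eq_span_pair[OF bU_ac]; unfold ee acte; use that nz in auto)
    show "X \<in> {(U.span {a, b}, UNIV), (U.span {a, c}, UNIV)}"
      using cases ker_ab ker_ac unfolding e'(3) by auto
  qed (use bars in auto)
  show "annihilator W (U.span {a, b}, UNIV) = E.span {z}"
  proof (intro subset_antisym subsetI)
    fix e' assume "e' \<in> annihilator W (U.span {a, b}, UNIV)"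
    moreover obtain p q r where ee: "e' = p *\<^sub>E x + q *\<^sub>E y + r *\<^sub>E z"
      using E.basis_list_tripleD(2)[OF bE] by blast
    ultimately show "e' \<in> E.span {z}"
      using nz acte[of p q r] unfolding annihilator_span_pair
      by (auto simp: E.span_scale E.span_base)
  qed (auto simp: annihilator_span_pair table E.span_singleton)
  show "annihilator W (U.span {a, c}, UNIV) = E.span {y}"
  proof (intro subset_antisym subsetI)
    fix e' assume "e' \<in> annihilator W (U.span {a, c}, UNIV)"
    moreover obtain p q r where ee: "e' = p *\<^sub>E x + q *\<^sub>E y + r *\<^sub>E z"
      using E.basis_list_tripleD(2)[OF bE] by blast
    ultimately show "e' \<in> E.span {y}"
      using nz acte[of p q r] unfolding annihilator_span_pair
      by (auto simp: E.span_scale E.span_base)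
  qed (auto simp: annihilator_span_pair table E.span_singleton)
qed

lemma table_type_3:
  assumes bV: "basis_list (scale1 W) [d, e]"
    and table: "x \<bullet> a = d" "x \<bullet> b = 0" "x \<bullet> c = 0"
      "y \<bullet> a = 0" "y \<bullet> b = d + e" "y \<bullet> c = 0"
      "z \<bullet> a = 0" "z \<bullet> b = 0" "z \<bullet> c = e"
  shows "basis_list sE [x, y, z]" "basis_list (scale0 W) [a, b, c]"
    "subbristles W = {generated W a, generated W b, generated W c}"
    "bars W = {(U.span {a, b}, UNIV), (U.span {a, c}, UNIV), (U.span {b, c}, UNIV)}"
    "annihilator W (U.span {a, b}, UNIV) = E.span {z}"
    "annihilator W (U.span {a, c}, UNIV) = E.span {y}"
    "annihilator W (U.span {b, c}, UNIV) = E.span {x}"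
    "bristle_type W = 3"
proof -
  note nz = basis_list_V_nonzero[OF bV]
  have actw: "x \<bullet> (\<alpha> *\<^sub>U a + \<beta> *\<^sub>U b + \<gamma> *\<^sub>U c) = \<alpha> *\<^sub>V d + 0 *\<^sub>V e"
    "y \<bullet> (\<alpha> *\<^sub>U a + \<beta> *\<^sub>U b + \<gamma> *\<^sub>U c) = \<beta> *\<^sub>V d + \<beta> *\<^sub>V e"
    "z \<bullet> (\<alpha> *\<^sub>U a + \<beta> *\<^sub>U b + \<gamma> *\<^sub>U c) = 0 *\<^sub>V d + \<gamma> *\<^sub>V e" for \<alpha> \<beta> \<gamma>
    by (simp_all add: table V.scale_right_distrib V.scale_left_distrib ac_simps)
  have acte: "(p *\<^sub>E x + q *\<^sub>E y + r *\<^sub>E z) \<bullet> a = p *\<^sub>V d + 0 *\<^sub>V e"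
    "(p *\<^sub>E x + q *\<^sub>E y + r *\<^sub>E z) \<bullet> b = q *\<^sub>V d + q *\<^sub>V e"
    "(p *\<^sub>E x + q *\<^sub>E y + r *\<^sub>E z) \<bullet> c = 0 *\<^sub>V d + r *\<^sub>V e" for p q r
    by (simp_all add: table V.scale_right_distrib V.scale_left_distrib ac_simps)
  show bE: "basis_list sE [x, y, z]"
  proof (rule E.basis_list_tripleI[OF dim_E])
    fix p q r assume *: "p *\<^sub>E x + q *\<^sub>E y + r *\<^sub>E z = 0"
    show "p = 0 \<and> q = 0 \<and> r = 0"
      using acte[of p q r] nz unfolding * by (simp add: eq_commute[of 0])
  qed
  show bU: "basis_list (scale0 W) [a, b, c]"
  proof (rule U.basis_list_tripleI[OF dim_U])
    fix \<alpha> \<beta> \<gamma> assume *: "\<alpha> *\<^sub>U a + \<beta> *\<^sub>U b + \<gamma> *\<^sub>U c = 0"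
    show "\<alpha> = 0 \<and> \<beta> = 0 \<and> \<gamma> = 0"
      using actw[of \<alpha> \<beta> \<gamma>] nz unfolding * by (simp add: eq_commute[of 0])
  qed
  note ind = U.basis_list_triple_independent[OF bU] and indE = E.basis_list_triple_independent[OF bE]
  \<comment> \<open>The minors are the three products of two different coefficients, so at most one
    coefficient survives; the same happens for \<open>p, q, r\<close> below.\<close>
  have subD: "(\<alpha> = 0 \<and> \<beta> = 0) \<or> (\<alpha> = 0 \<and> \<gamma> = 0) \<or> (\<beta> = 0 \<and> \<gamma> = 0)"
    if "range (\<lambda>e. e \<bullet> (\<alpha> *\<^sub>U a + \<beta> *\<^sub>U b + \<gamma> *\<^sub>U c)) \<subseteq> V.span {v}" for \<alpha> \<beta> \<gamma> v
    using in_line_proportional[OF bV that actw(1,2)] in_line_proportional[OF bV that actw(1,3)]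
      in_line_proportional[OF bV that actw(2,3)]
    by auto
  have barD': "(p = 0 \<and> q = 0) \<or> (p = 0 \<and> r = 0) \<or> (q = 0 \<and> r = 0)"
    if "range (\<lambda>m. (p *\<^sub>E x + q *\<^sub>E y + r *\<^sub>E z) \<bullet> m) \<subseteq> V.span {v}" for p q r v
    using in_line_proportional[OF bV that acte(1,2)] in_line_proportional[OF bV that acte(1,3)]
      in_line_proportional[OF bV that acte(2,3)]
    by auto
  have sub: "generated W a \<in> subbristles W" "generated W b \<in> subbristles W" "generated W c \<in> subbristles W"
    using subbristle_generated[OF ind(7) range_act_in_line[OF bE, of a "d"]]
      subbristle_generated[OF ind(8) range_act_in_line[OF bE, of b "d + e"]]
      subbristle_generated[OF ind(9) range_act_in_line[OF bE, of c "e"]]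
    by (simp_all add: table V.span_base V.span_zero)
  show subs: "subbristles W = {generated W a, generated W b, generated W c}"
  proof (intro subset_antisym subsetI)
    fix X assume "X \<in> subbristles W"
    then obtain w v where w: "w \<noteq> 0" "range (\<lambda>e. e \<bullet> w) \<subseteq> V.span {v}" "X = generated W w"
      using subbristleD by blast
    obtain \<alpha> \<beta> \<gamma> where ww: "w = \<alpha> *\<^sub>U a + \<beta> *\<^sub>U b + \<gamma> *\<^sub>U c"
      using U.basis_list_tripleD(2)[OF bU] by blast
    show "X \<in> {generated W a, generated W b, generated W c}"
      using subD[OF w(2)[unfolded ww]] w(1) generated_scale unfolding w(3) ww by auto
  qed (use sub in auto)
  show "bristle_type W = 3"
    using generated_neq[OF ind(1,4)] generated_neq[OF ind(2,5)] generated_neq[OF ind(3,6)]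
    by (simp add: bristle_type_def subs numeral_eq_enat)
  have bars: "(U.span {a, b}, UNIV) \<in> bars W" "(U.span {a, c}, UNIV) \<in> bars W" "(U.span {b, c}, UNIV) \<in> bars W"
    using barI[OF ind(1,4) indE(9)]
      barI[OF ind(2,5) indE(8)]
      barI[OF ind(3,6) indE(7)] by (simp_all add: table)
  have bU_ac: "basis_list (scale0 W) [a, c, b]" and bU_bc: "basis_list (scale0 W) [b, c, a]"
    using bU by (auto simp: basis_list_def insert_commute)
  show "bars W = {(U.span {a, b}, UNIV), (U.span {a, c}, UNIV), (U.span {b, c}, UNIV)}"
  proof (intro subset_antisym subsetI)
    fix X assume "X \<in> bars W"
    then obtain e' v where e': "e' \<noteq> 0" "range (\<lambda>m. e' \<bullet> m) \<subseteq> V.span {v}" "X = ({m. e' \<bullet> m = 0}, UNIV)"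
      using barD by blast
    obtain p q r where ee: "e' = p *\<^sub>E x + q *\<^sub>E y + r *\<^sub>E z"
      using E.basis_list_tripleD(2)[OF bE] by blast
    have cases: "(p = 0 \<and> q = 0 \<and> r \<noteq> 0) \<or> (p = 0 \<and> r = 0 \<and> q \<noteq> 0) \<or> (q = 0 \<and> r = 0 \<and> p \<noteq> 0)"
      using barD'[OF e'(2)[unfolded ee]] e'(1) unfolding ee by auto
    have ker_ab: "{m. e' \<bullet> m = 0} = U.span {a, b}" if "p = 0 \<and> q = 0 \<and> r \<noteq> 0"
      by (rule kernel_eq_span_pair[OF bU]; unfold ee acte; use that nz in auto)
    have ker_ac: "{m. e' \<bullet> m = 0} = U.span {a, c}" if "p = 0 \<and> r = 0 \<and> q \<noteq> 0"
      by (rule kernel_eq_span_pair[OF bU_ac]; unfold ee acte; use that nz in auto)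
    have ker_bc: "{m. e' \<bullet> m = 0} = U.span {b, c}" if "q = 0 \<and> r = 0 \<and> p \<noteq> 0"
      by (rule kernel_eq_span_pair[OF bU_bc]; unfold ee acte; use that nz in auto)
    show "X \<in> {(U.span {a, b}, UNIV), (U.span {a, c}, UNIV), (U.span {b, c}, UNIV)}"
      using cases ker_ab ker_ac ker_bc unfolding e'(3) by auto
  qed (use bars in auto)
  show "annihilator W (U.span {a, b}, UNIV) = E.span {z}"
  proof (intro subset_antisym subsetI)
    fix e' assume "e' \<in> annihilator W (U.span {a, b}, UNIV)"
    moreover obtain p q r where ee: "e' = p *\<^sub>E x + q *\<^sub>E y + r *\<^sub>E z"
      using E.basis_list_tripleD(2)[OF bE] by blast
    ultimately show "e' \<in> E.span {z}"
      using nz acte[of p q r] unfolding annihilator_span_pair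
      by (auto simp: E.span_scale E.span_base)
  qed (auto simp: annihilator_span_pair table E.span_singleton)
  show "annihilator W (U.span {a, c}, UNIV) = E.span {y}"
  proof (intro subset_antisym subsetI)
    fix e' assume "e' \<in> annihilator W (U.span {a, c}, UNIV)"
    moreover obtain p q r where ee: "e' = p *\<^sub>E x + q *\<^sub>E y + r *\<^sub>E z"
      using E.basis_list_tripleD(2)[OF bE] by blast
    ultimately show "e' \<in> E.span {y}"
      using nz acte[of p q r] unfolding annihilator_span_pair
      by (auto simp: E.span_scale E.span_base)
  qed (auto simp: annihilator_span_pair table E.span_singleton)
  show "annihilator W (U.span {b, c}, UNIV) = E.span {x}"
  proof (intro subset_antisym subsetI)
    fix e' assume "e' \<in> annihilator W (U.span {b, c}, UNIV)"
    moreover obtain p q r where ee: "e' = p *\<^sub>E x + q *\<^sub>E y + r *\<^sub>E z"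
      using E.basis_list_tripleD(2)[OF bE] by blast
    ultimately show "e' \<in> E.span {x}"
      using nz acte[of p q r] unfolding annihilator_span_pair
      by (auto simp: E.span_scale E.span_base)
  qed (auto simp: annihilator_span_pair table E.span_singleton)
qed

text \<open>The subbristles correspond to the lines in the plane spanned by \<open>a\<close> and
  \<open>b\<close>, so their number is infinite exactly when the field is; hence the hypothesis
  \<open>inf\<close>.\<close>

lemma table_type_infinity:
  assumes bV: "basis_list (scale1 W) [d, e]"
    and inf: "infinite (UNIV :: 'k set)"
    and table: "x \<bullet> a = d" "x \<bullet> b = e" "x \<bullet> c = 0"
      "y \<bullet> a = 0" "y \<bullet> b = 0" "y \<bullet> c = e"
      "z \<bullet> a = 0" "z \<bullet> b = 0" "z \<bullet> c = d"
  shows "basis_list sE [x, y, z]" "basis_list (scale0 W) [a, b, c]"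
    "subbristles W = generated W ` (U.span {a, b} - {0})"
    "bars W = {(U.span {a, b}, UNIV)}"
    "annihilator W (U.span {a, b}, UNIV) = E.span {y, z}"
    "bristle_type W = \<infinity>"
proof -
  note nz = basis_list_V_nonzero[OF bV]
  have actw: "x \<bullet> (\<alpha> *\<^sub>U a + \<beta> *\<^sub>U b + \<gamma> *\<^sub>U c) = \<alpha> *\<^sub>V d + \<beta> *\<^sub>V e"
    "y \<bullet> (\<alpha> *\<^sub>U a + \<beta> *\<^sub>U b + \<gamma> *\<^sub>U c) = 0 *\<^sub>V d + \<gamma> *\<^sub>V e"
    "z \<bullet> (\<alpha> *\<^sub>U a + \<beta> *\<^sub>U b + \<gamma> *\<^sub>U c) = \<gamma> *\<^sub>V d + 0 *\<^sub>V e" for \<alpha> \<beta> \<gamma>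
    by (simp_all add: table V.scale_right_distrib V.scale_left_distrib ac_simps)
  have acte: "(p *\<^sub>E x + q *\<^sub>E y + r *\<^sub>E z) \<bullet> a = p *\<^sub>V d + 0 *\<^sub>V e"
    "(p *\<^sub>E x + q *\<^sub>E y + r *\<^sub>E z) \<bullet> b = 0 *\<^sub>V d + p *\<^sub>V e"
    "(p *\<^sub>E x + q *\<^sub>E y + r *\<^sub>E z) \<bullet> c = r *\<^sub>V d + q *\<^sub>V e" for p q r
    by (simp_all add: table V.scale_right_distrib V.scale_left_distrib ac_simps)
  show bE: "basis_list sE [x, y, z]"
  proof (rule E.basis_list_tripleI[OF dim_E])
    fix p q r assume *: "p *\<^sub>E x + q *\<^sub>E y + r *\<^sub>E z = 0"
    show "p = 0 \<and> q = 0 \<and> r = 0"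
      using acte[of p q r] nz unfolding * by (simp add: eq_commute[of 0])
  qed
  show bU: "basis_list (scale0 W) [a, b, c]"
  proof (rule U.basis_list_tripleI[OF dim_U])
    fix \<alpha> \<beta> \<gamma> assume *: "\<alpha> *\<^sub>U a + \<beta> *\<^sub>U b + \<gamma> *\<^sub>U c = 0"
    show "\<alpha> = 0 \<and> \<beta> = 0 \<and> \<gamma> = 0"
      using actw[of \<alpha> \<beta> \<gamma>] nz unfolding * by (simp add: eq_commute[of 0])
  qed
  note ind = U.basis_list_triple_independent[OF bU] and indE = E.basis_list_triple_independent[OF bE]
  \<comment> \<open>The minors are \<alpha>\<gamma>, \<beta>\<gamma> and \<gamma>\<gamma> up to
    sign.\<close>
  have subD: "\<gamma> = 0"
    if "range (\<lambda>e. e \<bullet> (\<alpha> *\<^sub>U a + \<beta> *\<^sub>U b + \<gamma> *\<^sub>U c)) \<subseteq> V.span {v}" for \<alpha> \<beta> \<gamma> v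
    using in_line_proportional[OF bV that actw(1,2)] in_line_proportional[OF bV that actw(1,3)]
      in_line_proportional[OF bV that actw(2,3)]
    by auto
  have barD': "p = 0"
    if "range (\<lambda>m. (p *\<^sub>E x + q *\<^sub>E y + r *\<^sub>E z) \<bullet> m) \<subseteq> V.span {v}" for p q r v
    using in_line_proportional[OF bV that acte(1,2)] in_line_proportional[OF bV that acte(1,3)]
      in_line_proportional[OF bV that acte(2,3)]
    by auto
  show subs: "subbristles W = generated W ` (U.span {a, b} - {0})"
  proof (intro subset_antisym subsetI)
    fix X assume "X \<in> subbristles W"
    then obtain w v where w: "w \<noteq> 0" "range (\<lambda>e. e \<bullet> w) \<subseteq> V.span {v}" "X = generated W w"
      using subbristleD by blast
    obtain \<alpha> \<beta> \<gamma> where ww: "w = \<alpha> *\<^sub>U a + \<beta> *\<^sub>U b + \<gamma> *\<^sub>U c"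
      using U.basis_list_tripleD(2)[OF bU] by blast
    have "w = \<alpha> *\<^sub>U a + \<beta> *\<^sub>U b" using subD[OF w(2)[unfolded ww]] ww by simp
    then have "w \<in> U.span {a, b}" unfolding U.in_span_pair_iff by blast
    then show "X \<in> generated W ` (U.span {a, b} - {0})" using w by blast
  next
    fix X assume "X \<in> generated W ` (U.span {a, b} - {0})"
    then obtain w where w: "w \<noteq> 0" "w \<in> U.span {a, b}" "X = generated W w" by blast
    then obtain \<alpha> \<beta> where ww: "w = \<alpha> *\<^sub>U a + \<beta> *\<^sub>U b" unfolding U.in_span_pair_iff by blast
    have "range (\<lambda>e. e \<bullet> w) \<subseteq> V.span {\<alpha> *\<^sub>V d + \<beta> *\<^sub>V e}"
      (is "_ \<subseteq> V.span {?v}")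
    proof (rule range_act_in_line[OF bE])
      show "x \<bullet> w \<in> V.span {?v}" using V.span_base[of ?v "{?v}"] by (simp add: ww table)
    qed (simp_all add: ww table V.span_zero)
    then show "X \<in> subbristles W" using subbristle_generated w by blast
  qed
  have "infinite (subbristles W)"
  proof -
    \<comment> \<open>The lines through \<open>a + s b\<close> form an affine chart of the
      projective line: comparing the coefficients at \<open>a\<close> gives k = 1, and those at
      \<open>b\<close> then give s = t.\<close>
    have eqD: "s = t" if eq: "generated W (a + s *\<^sub>U b) = generated W (a + t *\<^sub>U b)" for s t
    proof -
      obtain k where "a + s *\<^sub>U b = k *\<^sub>U (a + t *\<^sub>U b)" using generated_eqD[OF eq] by blast
      moreover have "(1 - k) *\<^sub>U a + (s - k * t) *\<^sub>U b + 0 *\<^sub>U c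
          = (a + s *\<^sub>U b) - k *\<^sub>U (a + t *\<^sub>U b)"
        by (simp add: U.scale_right_distrib U.scale_left_diff_distrib)
      ultimately have "(1 - k) *\<^sub>U a + (s - k * t) *\<^sub>U b + 0 *\<^sub>U c = 0" by simp
      from U.basis_list_tripleD(1)[OF bU this] show ?thesis by simp
    qed
    then have "infinite (range (\<lambda>t. generated W (a + t *\<^sub>U b)))"
      using inf by (simp add: finite_image_iff inj_def)
    moreover have "range (\<lambda>t. generated W (a + t *\<^sub>U b)) \<subseteq> subbristles W"
    proof (rule image_subsetI)
      fix t
      have "a + t *\<^sub>U b \<noteq> 0" using U.basis_list_tripleD(1)[OF bU, of 1 t 0] by auto
      moreover have "a + t *\<^sub>U b \<in> U.span {a, b}"
        by (intro U.span_add U.span_scale U.span_base) auto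
      ultimately show "generated W (a + t *\<^sub>U b) \<in> subbristles W" unfolding subs by blast
    qed
    ultimately show ?thesis using finite_subset by blast
  qed
  then show "bristle_type W = \<infinity>" by (simp add: bristle_type_def)
  have bars: "(U.span {a, b}, UNIV) \<in> bars W"
    using barI[OF ind(1,4) indE(9)] by (simp_all add: table)
  show "bars W = {(U.span {a, b}, UNIV)}"
  proof (intro subset_antisym subsetI)
    fix X assume "X \<in> bars W"
    then obtain e' v where e': "e' \<noteq> 0" "range (\<lambda>m. e' \<bullet> m) \<subseteq> V.span {v}" "X = ({m. e' \<bullet> m = 0}, UNIV)"
      using barD by blast
    obtain p q r where ee: "e' = p *\<^sub>E x + q *\<^sub>E y + r *\<^sub>E z"
      using E.basis_list_tripleD(2)[OF bE] by blast
    have cases: "(p = 0 \<and> (q \<noteq> 0 \<or> r \<noteq> 0))"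
      using barD'[OF e'(2)[unfolded ee]] e'(1) unfolding ee by auto
    \<comment> \<open>All nonzero combinations of \<open>y\<close> and \<open>z\<close> share this
      kernel, so a whole plane of rank one elements yields a single bar.\<close>
    have ker_ab: "{m. e' \<bullet> m = 0} = U.span {a, b}" if "p = 0 \<and> (q \<noteq> 0 \<or> r \<noteq> 0)"
      by (rule kernel_eq_span_pair[OF bU]; unfold ee acte; use that nz in auto)
    show "X \<in> {(U.span {a, b}, UNIV)}"
      using cases ker_ab unfolding e'(3) by auto
  qed (use bars in auto)
  show "annihilator W (U.span {a, b}, UNIV) = E.span {y, z}"
  proof (intro subset_antisym subsetI)
    fix e' assume "e' \<in> annihilator W (U.span {a, b}, UNIV)"
    moreover obtain p q r where ee: "e' = p *\<^sub>E x + q *\<^sub>E y + r *\<^sub>E z"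
      using E.basis_list_tripleD(2)[OF bE] by blast
    ultimately show "e' \<in> E.span {y, z}"
      using nz acte[of p q r] unfolding annihilator_span_pair
      by (auto simp: E.in_span_pair_iff)
  qed (auto simp: annihilator_span_pair table E.in_span_pair_iff)
qed

end

section \<open>Singular matrix pencils\<close>

text \<open>Over a finite field, the product of all X - c, increased by 1, takes only the value 1
  and has no root.\<close>

lemma alg_closed_field_infinite: "infinite (UNIV :: 'a::alg_closed_field set)"
proof
  assume fin: "finite (UNIV :: 'a set)"
  define p :: "'a poly" where "p = (\<Prod>c\<in>UNIV. [:- c, 1:])"
  have "degree p = (\<Sum>c\<in>(UNIV :: 'a set). 1)"
    unfolding p_def by (subst degree_prod_eq_sum_degree) auto
  then have "degree p > 0" using fin by (simp add: card_gt_0_iff)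
  then have "degree (p + 1) > 0" by (subst degree_add_eq_left) auto
  then obtain r where r: "poly (p + 1) r = 0" using alg_closed_imp_poly_has_root by blast
  have "poly p r = 0" unfolding p_def poly_prod using fin by (intro prod_zero) auto
  with r show False by simp
qed

lemma det_2_eq_0_imp_kernel:
  fixes a b c d :: "'a::field"
  assumes "a * d = b * c"
  shows "\<exists>s t. (s \<noteq> 0 \<or> t \<noteq> 0) \<and> a * s + b * t = 0 \<and> c * s + d * t = 0"
proof (cases "a = 0 \<and> b = 0")
  case True
  show ?thesis
  proof (cases "c = 0 \<and> d = 0")
    case False
    then show ?thesis using True by (intro exI[of _ d] exI[of _ "- c"]) auto
  qed (use True in \<open>auto intro: exI[of _ 1]\<close>)
next
  case False
  then show ?thesis using assms
    by (intro exI[of _ b] exI[of _ "- a"]) (auto simp: algebra_simps)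
qed

text \<open>The cross product of two rows is orthogonal to both, and its pairing with the third row
  is the determinant up to sign. If all three cross products vanish, the rows are proportional and a
  solution for one row with a nonzero entry in the first two columns solves all.\<close>

lemma det_3_eq_0_imp_kernel:
  fixes a b c d e f g h i :: "'a::field"
  assumes det: "a * (e * i - f * h) - b * (d * i - f * g) + c * (d * h - e * g) = 0"
  shows "\<exists>u v w. (u \<noteq> 0 \<or> v \<noteq> 0 \<or> w \<noteq> 0) \<and>
    a * u + b * v + c * w = 0 \<and> d * u + e * v + f * w = 0 \<and> g * u + h * v + i * w = 0"
proof -
  have cross: ?thesis
    if "u \<noteq> 0 \<or> v \<noteq> 0 \<or> w \<noteq> 0" "a * u + b * v + c * w = 0"
      "d * u + e * v + f * w = 0" "g * u + h * v + i * w = 0" for u v w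
    using that by blast
  consider "b * f - c * e \<noteq> 0 \<or> c * d - a * f \<noteq> 0 \<or> a * e - b * d \<noteq> 0"
    | "b * i - c * h \<noteq> 0 \<or> c * g - a * i \<noteq> 0 \<or> a * h - b * g \<noteq> 0"
    | "e * i - f * h \<noteq> 0 \<or> f * g - d * i \<noteq> 0 \<or> d * h - e * g \<noteq> 0"
    | "b * f = c * e" "c * d = a * f" "a * e = b * d" "b * i = c * h" "c * g = a * i" "a * h = b * g"
      "e * i = f * h" "f * g = d * i" "d * h = e * g"
    by auto
  then show ?thesis
  proof cases
    case 1
    show ?thesis by (rule cross[OF 1]) (algebra | (use det in algebra))+
  next
    case 2
    show ?thesis by (rule cross[OF 2]) (algebra | (use det in algebra))+
  next
    case 3
    show ?thesis by (rule cross[OF 3]) (algebra | (use det in algebra))+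
  next
    case 4
    consider "a \<noteq> 0 \<or> b \<noteq> 0" | "d \<noteq> 0 \<or> e \<noteq> 0" | "g \<noteq> 0 \<or> h \<noteq> 0"
      | "a = 0" "b = 0" "d = 0" "e = 0" "g = 0" "h = 0" by blast
    then show ?thesis
    proof cases
      case 1
      show ?thesis by (rule cross[of b "- a" 0]) (use 1 4 in \<open>auto simp: algebra_simps\<close>)
    next
      case 2
      show ?thesis by (rule cross[of e "- d" 0]) (use 2 4 in \<open>auto simp: algebra_simps\<close>)
    next
      case 3
      show ?thesis by (rule cross[of h "- g" 0]) (use 3 4 in \<open>auto simp: algebra_simps\<close>)
    next
      case 4
      show ?thesis by (rule cross[of 1 0 0]) (use 4 in auto)
    qed
  qed
qed

text \<open>The determinant is a quadratic polynomial in \<open>t\<close> whose leading coefficient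
  is the determinant of the primed matrix. A singular primed matrix is the pencil's member at
  infinity and is treated separately, as the case of rank at most one.\<close>

lemma pencil_2_singular:
  fixes a b c d a' b' c' d' :: "'a::alg_closed_field"
  assumes "a' * d' - b' * c' \<noteq> 0"
  shows "\<exists>t. (a + t * a') * (d + t * d') = (b + t * b') * (c + t * c')"
proof -
  define p where "p = [:a, a':] * [:d, d':] - [:b, b':] * [:c, c':]"
  have "coeff p 2 = a' * d' - b' * c'"
    by (simp add: p_def numeral_2_eq_2 algebra_simps)
  then have "2 \<le> degree p" using assms by (intro le_degree) simp
  then obtain t where "poly p t = 0" using alg_closed_imp_poly_has_root[of p] by auto
  then show ?thesis unfolding p_def poly_add poly_diff poly_mult by (auto intro!: exI[of _ t])
qed

text \<open>Here the determinant is a cubic in \<open>t\<close>, again led by the determinant of the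
  primed matrix.\<close>

lemma pencil_3_singular:
  fixes a b c d e f g h i :: "'a::alg_closed_field"
  assumes "a' * (e' * i' - f' * h') - b' * (d' * i' - f' * g') + c' * (d' * h' - e' * g') \<noteq> 0"
  shows "\<exists>t. (a + t * a') * ((e + t * e') * (i + t * i') - (f + t * f') * (h + t * h'))
    - (b + t * b') * ((d + t * d') * (i + t * i') - (f + t * f') * (g + t * g'))
    + (c + t * c') * ((d + t * d') * (h + t * h') - (e + t * e') * (g + t * g')) = 0"
proof -
  define p where "p = [:a, a':] * ([:e, e':] * [:i, i':] - [:f, f':] * [:h, h':])
    - [:b, b':] * ([:d, d':] * [:i, i':] - [:f, f':] * [:g, g':])
    + [:c, c':] * ([:d, d':] * [:h, h':] - [:e, e':] * [:g, g':])"
  have "coeff p 3 = a' * (e' * i' - f' * h') - b' * (d' * i' - f' * g') + c' * (d' * h' - e' * g')"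
    by (simp add: p_def numeral_3_eq_3 algebra_simps)
  then have "3 \<le> degree p" using assms by (intro le_degree) simp
  then obtain t where "poly p t = 0" using alg_closed_imp_poly_has_root[of p] by auto
  then show ?thesis unfolding p_def poly_add poly_diff poly_mult by (auto intro!: exI[of _ t])
qed

section \<open>Normal forms\<close>

context special_module
begin

text \<open>The matrix of coefficients at \<open>v\<close> has rows indexed by
  \<open>x, y, z\<close> and columns by \<open>a, b, c\<close>. A kernel vector loses the
  \<open>v\<close>-part of all three products, which leaves only multiples of
  \<open>w\<close>.\<close>

lemma bristle_of_singular_matrix:
  assumes bE: "basis_list sE [x, y, z]" and bU: "basis_list (scale0 W) [a, b, c]"
    and acts: "x \<bullet> a = p1 *\<^sub>V v + q1 *\<^sub>V w" "x \<bullet> b = p2 *\<^sub>V v + q2 *\<^sub>V w" "x \<bullet> c = p3 *\<^sub>V v + q3 *\<^sub>V w"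
      "y \<bullet> a = p4 *\<^sub>V v + q4 *\<^sub>V w" "y \<bullet> b = p5 *\<^sub>V v + q5 *\<^sub>V w" "y \<bullet> c = p6 *\<^sub>V v + q6 *\<^sub>V w"
      "z \<bullet> a = p7 *\<^sub>V v + q7 *\<^sub>V w" "z \<bullet> b = p8 *\<^sub>V v + q8 *\<^sub>V w" "z \<bullet> c = p9 *\<^sub>V v + q9 *\<^sub>V w"
    and det: "p1 * (p5 * p9 - p6 * p8) - p2 * (p4 * p9 - p6 * p7) + p3 * (p4 * p8 - p5 * p7) = 0"
  shows "\<exists>m. m \<noteq> 0 \<and> range (\<lambda>e. e \<bullet> m) \<subseteq> V.span {w}"
proof -
  obtain \<alpha> \<beta> \<gamma> where nz: "\<alpha> \<noteq> 0 \<or> \<beta> \<noteq> 0 \<or> \<gamma> \<noteq> 0"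
    and ker: "p1 * \<alpha> + p2 * \<beta> + p3 * \<gamma> = 0" "p4 * \<alpha> + p5 * \<beta> + p6 * \<gamma> = 0" "p7 * \<alpha> + p8 * \<beta> + p9 * \<gamma> = 0"
    using det_3_eq_0_imp_kernel[OF det] by blast
  define m where "m = \<alpha> *\<^sub>U a + \<beta> *\<^sub>U b + \<gamma> *\<^sub>U c"
  have m: "m \<noteq> 0" using U.basis_list_tripleD(1)[OF bU] nz unfolding m_def by blast
  have "x \<bullet> m = (p1 * \<alpha> + p2 * \<beta> + p3 * \<gamma>) *\<^sub>V v + (q1 * \<alpha> + q2 * \<beta> + q3 * \<gamma>) *\<^sub>V w"
    "y \<bullet> m = (p4 * \<alpha> + p5 * \<beta> + p6 * \<gamma>) *\<^sub>V v + (q4 * \<alpha> + q5 * \<beta> + q6 * \<gamma>) *\<^sub>V w"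
    "z \<bullet> m = (p7 * \<alpha> + p8 * \<beta> + p9 * \<gamma>) *\<^sub>V v + (q7 * \<alpha> + q8 * \<beta> + q9 * \<gamma>) *\<^sub>V w"
    by (simp_all add: m_def acts V.scale_right_distrib V.scale_left_distrib mult.commute ac_simps)
  then have xyz: "x \<bullet> m \<in> V.span {w}" "y \<bullet> m \<in> V.span {w}" "z \<bullet> m \<in> V.span {w}"
    unfolding ker by (simp_all add: V.span_scale V.span_base)
  show ?thesis using range_act_in_line[OF bE xyz] m by blast
qed

text \<open>This is the condition preserved by all later changes: \<open>a\<close> and
  \<open>d\<close> stay fixed, \<open>y, z\<close> may be mixed and added to \<open>x\<close>,
  \<open>b, c\<close> may be mixed and altered by multiples of \<open>a\<close>, and
  \<open>e\<close> may be rescaled and altered by multiples of \<open>d\<close>.\<close>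

definition frame where
  "frame x y z a b c d e \<longleftrightarrow>
    basis_list sE [x, y, z] \<and> basis_list (scale0 W) [a, b, c] \<and> basis_list (scale1 W) [d, e] \<and>
    x \<bullet> a = d \<and> y \<bullet> a = 0 \<and> z \<bullet> a = 0"

lemma exists_frame:
  assumes "a \<noteq> 0" and line: "range (\<lambda>e. e \<bullet> a) \<subseteq> V.span {v}"
  shows "\<exists>x y z b c d e. frame x y z a b c d e"
proof -
  obtain b c where bU: "basis_list (scale0 W) [a, b, c]"
    using U.extend_basis_triple[OF dim_U assms(1)] by blast
  obtain x where x: "x \<bullet> a \<noteq> 0" using act_nonzero[OF assms(1)] by blast
  then have "x \<noteq> 0" by auto
  then obtain y z where bE: "basis_list sE [x, y, z]"
    using E.extend_basis_triple[OF dim_E] by blast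
  define d where "d = x \<bullet> a"
  obtain e where bV: "basis_list (scale1 W) [d, e]"
    using V.extend_basis_pair[OF dim_V] x unfolding d_def by blast
  have "\<exists>k. y \<bullet> a = k *\<^sub>V d" for y
  proof -
    have "x \<bullet> a \<in> V.span {v}" "y \<bullet> a \<in> V.span {v}" using line by blast+
    then obtain k l where kl: "x \<bullet> a = k *\<^sub>V v" "y \<bullet> a = l *\<^sub>V v" by (auto simp: V.span_singleton)
    with x have "k \<noteq> 0" by auto
    then have "y \<bullet> a = (l / k) *\<^sub>V d" by (simp add: kl d_def)
    then show ?thesis by blast
  qed
  then obtain k l where kl: "y \<bullet> a = k *\<^sub>V d" "z \<bullet> a = l *\<^sub>V d" by meson
  \<comment> \<open>Subtracting the right multiples of \<open>x\<close> makes \<open>y\<close> and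
    \<open>z\<close> annihilate \<open>a\<close>; the coefficients 0 and 1 only match the shape of
    the change lemma.\<close>
  have "basis_list sE [x, 1 *\<^sub>E y + 0 *\<^sub>E z + (- k) *\<^sub>E x, 0 *\<^sub>E y + 1 *\<^sub>E z + (- l) *\<^sub>E x]"
    by (rule E.basis_list_triple_change_tail[OF bE]) simp
  then have "frame x (1 *\<^sub>E y + 0 *\<^sub>E z + (- k) *\<^sub>E x) (0 *\<^sub>E y + 1 *\<^sub>E z + (- l) *\<^sub>E x) a b c d e"
    unfolding frame_def using bU bV by (simp add: kl d_def)
  then show ?thesis by blast
qed

section \<open>Changes that preserve a frame\<close>

lemma frame_change_E_tail:
  assumes "frame x y z a b c d e" "k * l' \<noteq> l * k'"
  shows "frame x (k *\<^sub>E y + l *\<^sub>E z) (k' *\<^sub>E y + l' *\<^sub>E z) a b c d e"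
  using assms E.basis_list_triple_change_tail[of x y z k l' l k' 0 0] unfolding frame_def by simp

lemma frame_change_E_head:
  assumes "frame x y z a b c d e"
  shows "frame (x + k *\<^sub>E y + l *\<^sub>E z) y z a b c d e"
  using assms E.basis_list_triple_change_head[of x y z k l] unfolding frame_def by simp

lemma frame_change_U:
  assumes "frame x y z a b c d e" "k * l' \<noteq> l * k'"
  shows "frame x y z a (k *\<^sub>U b + l *\<^sub>U c + m *\<^sub>U a) (k' *\<^sub>U b + l' *\<^sub>U c + m' *\<^sub>U a) d e"
  using assms U.basis_list_triple_change_tail[of a b c k l' l k' m m'] unfolding frame_def by simp

lemma frame_change_V:
  assumes fr: "frame x y z a b c d e" and e': "e' = k *\<^sub>V d + l *\<^sub>V e" "l \<noteq> 0"
  shows "frame x y z a b c d e'"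
proof -
  have "basis_list (scale1 W) [1 *\<^sub>V d + 0 *\<^sub>V e, k *\<^sub>V d + l *\<^sub>V e]"
    by (rule V.basis_list_pair_change) (use assms in \<open>auto simp: frame_def\<close>)
  then show ?thesis using fr by (simp add: frame_def e')
qed

lemma frame_coordinates:
  assumes "frame x y z a b c d e"
  shows "\<exists>p q. v = p *\<^sub>V d + q *\<^sub>V e"
  using assms V.basis_list_pairD(2) unfolding frame_def by blast

text \<open>If \<open>y\<close> and \<open>z\<close> act with values in \<open>\<langle>d\<rangle>\<close>, then \<open>m \<mapsto> \<xi>(m) a\<close>, where \<open>\<xi>(m)\<close> is the coefficient
  of \<open>x m\<close> at \<open>e\<close>, and \<open>d \<mapsto> 0\<close>, \<open>e \<mapsto> d\<close> define a nilpotent endomorphism.\<close>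

lemma frame_not_all_in_line:
  assumes fr: "frame x y z a b c d e"
    and acts: "y \<bullet> b = p1 *\<^sub>V d" "y \<bullet> c = p2 *\<^sub>V d" "z \<bullet> b = p3 *\<^sub>V d" "z \<bullet> c = p4 *\<^sub>V d"
  shows False
proof -
  have bE: "basis_list sE [x, y, z]" and bU: "basis_list (scale0 W) [a, b, c]"
    and bV: "basis_list (scale1 W) [d, e]" and fa: "x \<bullet> a = d" "y \<bullet> a = 0" "z \<bullet> a = 0"
    using fr by (simp_all add: frame_def)
  obtain s1 t1 s2 t2 where x: "x \<bullet> b = s1 *\<^sub>V d + t1 *\<^sub>V e" "x \<bullet> c = s2 *\<^sub>V d + t2 *\<^sub>V e"
    using frame_coordinates[OF fr] by meson
  obtain f where f: "Vector_Spaces.linear (scale0 W) (scale0 W) f" "f a = 0" "f b = t1 *\<^sub>U a" "f c = t2 *\<^sub>U a"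
    using UU.linear_extend_triple[OF bU] by blast
  obtain g where g: "Vector_Spaces.linear (scale1 W) (scale1 W) g" "g d = 0" "g e = d"
    using VV.linear_extend_pair[OF bV] by blast
  note lin = VV.linear_add[OF g(1)] VV.linear_scale[OF g(1)] VV.linear_0[OF g(1)]
  have "\<exists>k. f = scale0 W k \<and> g = scale1 W k"
    by (rule endomorphism_on_basis[OF bE bU f(1) g(1)]) (auto simp: lin f(2-) g(2-) fa acts x)
  then obtain k where "g = scale1 W k" by blast
  then have "1 *\<^sub>V d + (- k) *\<^sub>V e = 0" using g(3) by simp
  then show False unfolding basis_list_V_nonzero(1)[OF bV] by simp
qed

text \<open>Since Q is singular, some combination of \<open>y\<close> and \<open>z\<close> maps into
  the line of \<open>d\<close>; it becomes the new \<open>y\<close>. By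
  \<open>frame_not_all_in_line\<close> the new \<open>z\<close> does not, and its coefficient at
  \<open>e\<close> is a nonzero functional on \<open>b, c\<close>. Take \<open>b\<close> in its
  kernel, \<open>c\<close> of value 1, and let \<open>z c\<close> be the new
  \<open>e\<close>.\<close>

lemma frame_rank_1:
  assumes fr: "frame x y z a b c d e"
    and acts: "y \<bullet> b = p1 *\<^sub>V d + q1 *\<^sub>V e" "y \<bullet> c = p2 *\<^sub>V d + q2 *\<^sub>V e"
      "z \<bullet> b = p3 *\<^sub>V d + q3 *\<^sub>V e" "z \<bullet> c = p4 *\<^sub>V d + q4 *\<^sub>V e"
    and det: "q1 * q4 = q2 * q3"
  shows "\<exists>x y z b c e p q r t. frame x y z a b c d e \<and>
    x \<bullet> b = t *\<^sub>V e \<and> x \<bullet> c = 0 \<and> y \<bullet> b = p *\<^sub>V d \<and> y \<bullet> c = q *\<^sub>V d \<and> z \<bullet> b = r *\<^sub>V d \<and> z \<bullet> c = e"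
proof -
  obtain k l where kl: "k \<noteq> 0 \<or> l \<noteq> 0" "q1 * k + q3 * l = 0" "q2 * k + q4 * l = 0"
    using det_2_eq_0_imp_kernel[of q1 q4 q3 q2] det by (auto simp: mult.commute)
  obtain k' l' where kl': "k * l' \<noteq> l * k'" using kl(1) by (metis mult_1_right mult_zero_right)
  have "(k *\<^sub>E y + l *\<^sub>E z) \<bullet> b = (p1 * k + p3 * l) *\<^sub>V d + (q1 * k + q3 * l) *\<^sub>V e"
    "(k *\<^sub>E y + l *\<^sub>E z) \<bullet> c = (p2 * k + p4 * l) *\<^sub>V d + (q2 * k + q4 * l) *\<^sub>V e"
    by (simp_all add: acts V.scale_right_distrib V.scale_left_distrib ac_simps)
  then obtain y z p q where fr1: "frame x y z a b c d e" and y1: "y \<bullet> b = p *\<^sub>V d" "y \<bullet> c = q *\<^sub>V d"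
    using frame_change_E_tail[OF fr kl'] unfolding kl V.scale_zero_left add_0_right by blast
  obtain r1 u r2 v where z1: "z \<bullet> b = r1 *\<^sub>V d + u *\<^sub>V e" "z \<bullet> c = r2 *\<^sub>V d + v *\<^sub>V e"
    using frame_coordinates[OF fr1] by meson
  have uv: "u \<noteq> 0 \<or> v \<noteq> 0"
    using frame_not_all_in_line[OF fr1 y1, of r1 r2] z1 by auto
  obtain m n where mn: "u * m + v * n = 1"
    using uv by (metis add.commute add_0_right mult_zero_right right_inverse)
  \<comment> \<open>The functional has values \<open>u\<close> and \<open>v\<close> at the old
    \<open>b\<close> and \<open>c\<close>: the new \<open>b\<close> lies in its kernel, the new
    \<open>c\<close> has value 1, and that value is also the determinant of the change.\<close>
  have fr2: "frame x y z a (v *\<^sub>U b + (- u) *\<^sub>U c + 0 *\<^sub>U a) (m *\<^sub>U b + n *\<^sub>U c + 0 *\<^sub>U a) d e"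
    (is "frame x y z a ?b ?c d e")
    by (rule frame_change_U[OF fr1]) (use mn in \<open>auto simp: algebra_simps eq_neg_iff_add_eq_0\<close>)
  have "z \<bullet> ?b = (v * r1 - u * r2) *\<^sub>V d"
    by (simp add: z1 V.scale_right_distrib V.scale_left_diff_distrib mult.commute algebra_simps)
  moreover have zc: "z \<bullet> ?c = (m * r1 + n * r2) *\<^sub>V d + (u * m + v * n) *\<^sub>V e"
    by (simp add: z1 V.scale_right_distrib V.scale_left_distrib ac_simps)
  moreover have "y \<bullet> ?b = (v * p - u * q) *\<^sub>V d" "y \<bullet> ?c = (m * p + n * q) *\<^sub>V d"
    by (simp_all add: y1 V.scale_left_diff_distrib V.scale_left_distrib)
  ultimately have acts2: "y \<bullet> ?b = (v * p - u * q) *\<^sub>V d" "y \<bullet> ?c = (m * p + n * q) *\<^sub>V d"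
    "z \<bullet> ?b = (v * r1 - u * r2) *\<^sub>V d" by blast+
  have "frame x y z a ?b ?c d (z \<bullet> ?c)"
    using frame_change_V[OF fr2 _ one_neq_zero] zc mn by simp
  with acts2 obtain b c e' p' q' r' where fr3: "frame x y z a b c d e'" and
    t2: "y \<bullet> b = p' *\<^sub>V d" "y \<bullet> c = q' *\<^sub>V d" "z \<bullet> b = r' *\<^sub>V d" and zc: "e' = z \<bullet> c"
    by blast
  obtain s1 t1 s2 t2' where xx: "x \<bullet> b = s1 *\<^sub>V d + t1 *\<^sub>V e'" "x \<bullet> c = s2 *\<^sub>V d + t2' *\<^sub>V e'"
    using frame_coordinates[OF fr3] by meson
  \<comment> \<open>Subtracting \<open>t2' z\<close> clears the coefficient of \<open>x c\<close> at
    \<open>e'\<close> but adds \<open>- t2' r' d\<close> to \<open>x b\<close>; multiples of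
    \<open>a\<close> then remove all remaining multiples of \<open>d\<close>, because
    \<open>x a = d\<close>.\<close>
  let ?x = "x + 0 *\<^sub>E y + (- t2') *\<^sub>E z"
  let ?b = "1 *\<^sub>U b + 0 *\<^sub>U c + (t2' * r' - s1) *\<^sub>U a" and ?c = "0 *\<^sub>U b + 1 *\<^sub>U c + (- s2) *\<^sub>U a"
  have fr4: "frame ?x y z a ?b ?c d e'"
    by (intro frame_change_U frame_change_E_head fr3) simp
  have fa: "x \<bullet> a = d" "y \<bullet> a = 0" "z \<bullet> a = 0" using fr3 by (simp_all add: frame_def)
  have "?x \<bullet> ?b = t1 *\<^sub>V e'" "?x \<bullet> ?c = 0" "y \<bullet> ?b = p' *\<^sub>V d" "y \<bullet> ?c = q' *\<^sub>V d"
    "z \<bullet> ?b = r' *\<^sub>V d" "z \<bullet> ?c = e'"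
    by (simp_all add: fa xx t2 zc[symmetric] V.scale_left_diff_distrib)
  with fr4 show ?thesis by blast
qed

text \<open>The root \<open>t\<close> makes P + tQ singular, and its kernel vector serves as
  \<open>b\<close>, so the first column of P becomes zero. Mixing \<open>y\<close> and
  \<open>z\<close> by the inverse of Q, now possible, makes Q the identity and keeps that column
  zero.\<close>

lemma frame_rank_2:
  assumes fr: "frame x y z a b c d e"
    and acts: "y \<bullet> b = p1 *\<^sub>V d + q1 *\<^sub>V e" "y \<bullet> c = p2 *\<^sub>V d + q2 *\<^sub>V e"
      "z \<bullet> b = p3 *\<^sub>V d + q3 *\<^sub>V e" "z \<bullet> c = p4 *\<^sub>V d + q4 *\<^sub>V e"
    and det: "q1 * q4 - q2 * q3 \<noteq> 0" and sing: "(p1 + t * q1) * (p4 + t * q4) = (p2 + t * q2) * (p3 + t * q3)"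
  shows "\<exists>x y z b c e q s. frame x y z a b c d e \<and>
    x \<bullet> b = 0 \<and> x \<bullet> c = 0 \<and> y \<bullet> b = e \<and> y \<bullet> c = q *\<^sub>V d \<and> z \<bullet> b = 0 \<and> z \<bullet> c = s *\<^sub>V d + e"
proof -
  \<comment> \<open>Substituting \<open>e = e1 + t d\<close> turns P into P + tQ and leaves Q
    unchanged.\<close>
  define e1 where "e1 = (- t) *\<^sub>V d + 1 *\<^sub>V e"
  have fr1: "frame x y z a b c d e1" by (rule frame_change_V[OF fr e1_def]) simp
  have acts1: "y \<bullet> b = (p1 + t * q1) *\<^sub>V d + q1 *\<^sub>V e1" "y \<bullet> c = (p2 + t * q2) *\<^sub>V d + q2 *\<^sub>V e1"
      "z \<bullet> b = (p3 + t * q3) *\<^sub>V d + q3 *\<^sub>V e1" "z \<bullet> c = (p4 + t * q4) *\<^sub>V d + q4 *\<^sub>V e1"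
    by (simp_all add: acts e1_def V.scale_right_diff_distrib V.scale_left_distrib mult.commute)
  obtain k l where kl: "k \<noteq> 0 \<or> l \<noteq> 0" "(p1 + t * q1) * k + (p2 + t * q2) * l = 0"
      "(p3 + t * q3) * k + (p4 + t * q4) * l = 0"
    using det_2_eq_0_imp_kernel[OF sing] by blast
  obtain k' l' where kl': "k * l' \<noteq> l * k'" using kl(1) by (metis mult_1_right mult_zero_right)
  have fr2: "frame x y z a (k *\<^sub>U b + l *\<^sub>U c + 0 *\<^sub>U a) (k' *\<^sub>U b + l' *\<^sub>U c + 0 *\<^sub>U a) d e1"
    (is "frame x y z a ?b ?c d e1")
    by (rule frame_change_U[OF fr1 kl'])
  have "y \<bullet> ?b = ((p1 + t * q1) * k + (p2 + t * q2) * l) *\<^sub>V d + (q1 * k + q2 * l) *\<^sub>V e1"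
      "z \<bullet> ?b = ((p3 + t * q3) * k + (p4 + t * q4) * l) *\<^sub>V d + (q3 * k + q4 * l) *\<^sub>V e1"
    by (simp_all add: acts1 V.scale_right_distrib V.scale_left_distrib algebra_simps)
  then have b2: "y \<bullet> ?b = (q1 * k + q2 * l) *\<^sub>V e1" "z \<bullet> ?b = (q3 * k + q4 * l) *\<^sub>V e1"
    unfolding kl by simp_all
  obtain r1 r2 where c2: "y \<bullet> ?c = r1 *\<^sub>V d + (q1 * k' + q2 * l') *\<^sub>V e1"
      "z \<bullet> ?c = r2 *\<^sub>V d + (q3 * k' + q4 * l') *\<^sub>V e1"
  proof
    show "y \<bullet> ?c = (k' * (p1 + t * q1) + l' * (p2 + t * q2)) *\<^sub>V d + (q1 * k' + q2 * l') *\<^sub>V e1"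
      "z \<bullet> ?c = (k' * (p3 + t * q3) + l' * (p4 + t * q4)) *\<^sub>V d + (q3 * k' + q4 * l') *\<^sub>V e1"
      by (simp_all add: acts1 V.scale_right_distrib V.scale_left_distrib algebra_simps)
  qed
  define A B C D where "A = q1 * k + q2 * l" and "B = q1 * k' + q2 * l'"
    and "C = q3 * k + q4 * l" and "D = q3 * k' + q4 * l'"
  note b2 = b2[folded A_def C_def] and c2 = c2[folded B_def D_def]
  have "A * D - B * C = (q1 * q4 - q2 * q3) * (k * l' - l * k')"
    unfolding A_def B_def C_def D_def by algebra
  then have \<Delta>: "A * D - B * C \<noteq> 0" using det kl' by simp
  obtain b c where bc: "b = ?b" "c = ?c" by blast
  note fr2 = fr2[folded bc] and b2 = b2[folded bc] and c2 = c2[folded bc]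
  \<comment> \<open>The new \<open>y\<close> and \<open>z\<close> are given by the rows of the
    inverse of the matrix with rows \<open>A, B\<close> and \<open>C, D\<close>.\<close>
  define i where "i = inverse (A * D - B * C)"
  have i: "i * (A * D - B * C) = 1" using \<Delta> by (simp add: i_def)
  have "(i * D) * (i * A) - (- (i * B)) * (- (i * C)) = i * (i * (A * D - B * C))" by algebra
  also have "\<dots> \<noteq> 0" using i by auto
  finally have "(i * D) * (i * A) \<noteq> (- (i * B)) * (- (i * C))" by simp
  then have fr3: "frame x ((i * D) *\<^sub>E y + (- (i * B)) *\<^sub>E z) ((- (i * C)) *\<^sub>E y + (i * A) *\<^sub>E z) a b c d e1"
    (is "frame x ?y ?z a b c d e1")
    by (rule frame_change_E_tail[OF fr2])
  have "?y \<bullet> b = (i * D * A - i * B * C) *\<^sub>V e1" "?z \<bullet> b = (i * A * C - i * C * A) *\<^sub>V e1"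
    "?y \<bullet> c = (i * D * r1 - i * B * r2) *\<^sub>V d + (i * D * B - i * B * D) *\<^sub>V e1"
    "?z \<bullet> c = (i * A * r2 - i * C * r1) *\<^sub>V d + (i * A * D - i * C * B) *\<^sub>V e1"
    by (simp_all add: b2 c2 V.scale_right_distrib V.scale_left_diff_distrib algebra_simps)
  moreover have "i * D * A - i * B * C = 1" "i * A * D - i * C * B = 1"
    "i * A * C - i * C * A = 0" "i * D * B - i * B * D = 0"
    using i by algebra+
  ultimately obtain q s where t3: "?y \<bullet> b = e1" "?z \<bullet> b = 0" "?y \<bullet> c = q *\<^sub>V d" "?z \<bullet> c = s *\<^sub>V d + e1"
    by auto
  obtain y z where yz: "y = ?y" "z = ?z" by blast
  note fr3 = fr3[folded yz] and t3 = t3[folded yz]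
  obtain s1 t1 s2 t2 where xx: "x \<bullet> b = s1 *\<^sub>V d + t1 *\<^sub>V e1" "x \<bullet> c = s2 *\<^sub>V d + t2 *\<^sub>V e1"
    using frame_coordinates[OF fr3] by meson
  \<comment> \<open>As Q is the identity, subtracting \<open>t1 y + t2 z\<close> removes the parts
    of \<open>x b\<close> and \<open>x c\<close> along \<open>e1\<close>; the multiples of
    \<open>a\<close> then absorb what is left along \<open>d\<close>.\<close>
  let ?x = "x + (- t1) *\<^sub>E y + (- t2) *\<^sub>E z"
  let ?b = "1 *\<^sub>U b + 0 *\<^sub>U c + (- s1) *\<^sub>U a" and ?c = "0 *\<^sub>U b + 1 *\<^sub>U c + (t1 * q + t2 * s - s2) *\<^sub>U a"
  have fr4: "frame ?x y z a ?b ?c d e1"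
    by (intro frame_change_U frame_change_E_head fr3) simp
  have fa: "x \<bullet> a = d" "y \<bullet> a = 0" "z \<bullet> a = 0" using fr3 by (simp_all add: frame_def)
  have "?x \<bullet> ?b = 0" "?x \<bullet> ?c = 0" "y \<bullet> ?b = e1" "y \<bullet> ?c = q *\<^sub>V d" "z \<bullet> ?b = 0" "z \<bullet> ?c = s *\<^sub>V d + e1"
    by (simp_all add: fa xx t3 V.scale_right_distrib V.scale_left_diff_distrib V.scale_left_distrib)
  with fr4 show ?thesis by blast
qed

section \<open>Reduction to the four tables\<close>

definition products where
  "products x y z a b c = map (\<lambda>e. map (act W e) [a, b, c]) [x, y, z]"

text \<open>Rows belong to \<open>x, y, z\<close> and columns to \<open>a, b, c\<close>. Only
  \<open>d, e\<close> are required to be a basis, because each table forces the other two triples to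
  be bases.\<close>

definition has_normal_form where
  "has_normal_form \<longleftrightarrow> (\<exists>x y z a b c d e. basis_list (scale1 W) [d, e] \<and>
    products x y z a b c \<in>
      {[[d, e, 0], [0, d, e], [0, 0, d]],
       [[d, e, 0], [0, d, 0], [0, 0, e]],
       [[d, 0, 0], [0, d + e, 0], [0, 0, e]],
       [[d, e, 0], [0, 0, e], [0, 0, d]]})"

text \<open>Faithfulness excludes \<open>y = 0\<close>, so \<open>p\<close> or \<open>q\<close> is
  nonzero, and \<open>t = 0\<close> would admit a nonscalar endomorphism. Nonzero \<open>p\<close>
  leads to the type 2 table; for \<open>p = 0\<close> the table is that of type 1 or of type
  infinity according to whether \<open>r\<close> is nonzero.\<close>

lemma normal_form_rank_1:
  assumes fr: "frame x y z a b c d e"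
    and acts: "x \<bullet> b = t *\<^sub>V e" "x \<bullet> c = 0" "y \<bullet> b = p *\<^sub>V d" "y \<bullet> c = q *\<^sub>V d"
      "z \<bullet> b = r *\<^sub>V d" "z \<bullet> c = e"
  shows has_normal_form
proof -
  have bE: "basis_list sE [x, y, z]" and bU: "basis_list (scale0 W) [a, b, c]"
    and bV: "basis_list (scale1 W) [d, e]" and fa: "x \<bullet> a = d" "y \<bullet> a = 0" "z \<bullet> a = 0"
    using fr by (simp_all add: frame_def)
  have pq: "p \<noteq> 0 \<or> q \<noteq> 0"
  proof (rule ccontr)
    assume "\<not> ?thesis"
    then have "y \<bullet> m = 0" for m
      using U.basis_list_tripleD(2)[OF bU, of m] acts fa by auto
    then have "y = 0" by (rule faithfulD)
    then show False using E.basis_list_tripleD(1)[OF bE, of 0 1 0] by simp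
  qed
  have "t \<noteq> 0"
  proof
    assume t: "t = 0"
    \<comment> \<open>The endomorphism is \<open>p\<close> on \<open>a, b, d\<close> and \<open>0\<close> on \<open>c, e\<close> modulo these; the remaining entries
      \<open>q\<close> and \<open>rq\<close> are forced by compatibility with \<open>y\<close> and \<open>z\<close>.\<close>
    obtain f where f: "Vector_Spaces.linear (scale0 W) (scale0 W) f"
        "f a = p *\<^sub>U a" "f b = p *\<^sub>U b" "f c = q *\<^sub>U b"
      using UU.linear_extend_triple[OF bU] by blast
    obtain g where g: "Vector_Spaces.linear (scale1 W) (scale1 W) g"
        "g d = p *\<^sub>V d" "g e = (r * q) *\<^sub>V d"
      using VV.linear_extend_pair[OF bV] by blast
    note lin = VV.linear_add[OF g(1)] VV.linear_scale[OF g(1)] VV.linear_0[OF g(1)]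
    have "\<exists>k. f = scale0 W k \<and> g = scale1 W k"
      by (rule endomorphism_on_basis[OF bE bU f(1) g(1)])
        (auto simp: lin f(2-) g(2-) fa acts t mult.commute)
    then obtain k where k: "f = scale0 W k" by blast
    have "0 *\<^sub>U a + q *\<^sub>U b + (- k) *\<^sub>U c = 0" using f(4) by (simp add: k)
    from U.basis_list_tripleD(1)[OF bU this] have "q = 0" "k = 0" by auto
    moreover have "p = 0" using f(2) U.basis_list_triple_independent(7)[OF bU] \<open>k = 0\<close> by (simp add: k)
    ultimately show False using pq by simp
  qed
  define b1 where "b1 = inverse t *\<^sub>U b"
  define p1 where "p1 = inverse t * p"
  define r1 where "r1 = inverse t * r"
  have acts1: "x \<bullet> b1 = e" "y \<bullet> b1 = p1 *\<^sub>V d" "z \<bullet> b1 = r1 *\<^sub>V d"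
    using \<open>t \<noteq> 0\<close> by (simp_all add: b1_def p1_def r1_def acts)
  have pq1: "p1 \<noteq> 0 \<or> q \<noteq> 0" using pq \<open>t \<noteq> 0\<close> by (simp add: p1_def)
  consider "p1 \<noteq> 0" | "p1 = 0" "q \<noteq> 0" "r1 \<noteq> 0" | "p1 = 0" "q \<noteq> 0" "r1 = 0" using pq1 by blast
  then show ?thesis
  proof cases
    case 1
    \<comment> \<open>\<open>z1\<close> clears the product with \<open>b1\<close>, which shifts
      \<open>e\<close> to \<open>e1\<close>, and \<open>c - u b1\<close> clears the product with
      \<open>y1\<close>. This creates \<open>- u e\<close> in \<open>x c1\<close>: adding
      \<open>u z1\<close> to \<open>x\<close> cancels it up to \<open>- u u r1 d\<close>, which the
      multiple of \<open>a\<close> in \<open>c1\<close> removes. The multiple of \<open>a\<close> in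
      \<open>b2\<close> turns \<open>x b2\<close> into \<open>e1\<close>.\<close>
    define u where "u = q / p1"
    define y1 where "y1 = inverse p1 *\<^sub>E y"
    define z1 where "z1 = z - r1 *\<^sub>E y1"
    define c1 where "c1 = c - u *\<^sub>U b1 + (u * u * r1) *\<^sub>U a"
    define e1 where "e1 = (- (r1 * u)) *\<^sub>V d + 1 *\<^sub>V e"
    define x1 where "x1 = x + u *\<^sub>E z1"
    define b2 where "b2 = b1 - (r1 * u) *\<^sub>U a"
    have "basis_list (scale1 W) [1 *\<^sub>V d + 0 *\<^sub>V e, e1]"
      unfolding e1_def by (rule V.basis_list_pair_change[OF bV]) simp
    then have "basis_list (scale1 W) [d, e1]" by simp
    moreover have y1: "y1 \<bullet> a = 0" "y1 \<bullet> b1 = d" "y1 \<bullet> c = u *\<^sub>V d"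
      using 1 by (simp_all add: y1_def acts acts1 fa u_def field_simps)
    moreover have z1: "z1 \<bullet> a = 0" "z1 \<bullet> b1 = 0" "z1 \<bullet> c = e1"
      by (simp_all add: z1_def y1 acts acts1 fa e1_def)
    moreover have "products x1 y1 z1 a b2 c1 = [[d, e1, 0], [0, d, 0], [0, 0, e1]]"
      by (simp add: products_def x1_def b2_def c1_def y1 z1 acts acts1 fa)
        (simp add: e1_def V.scale_right_distrib V.scale_right_diff_distrib algebra_simps)
    ultimately show ?thesis unfolding has_normal_form_def by blast
  next
    case 2
    have "basis_list (scale1 W) [r1 *\<^sub>V d + 0 *\<^sub>V e, 0 *\<^sub>V d + 1 *\<^sub>V e]"
      by (rule V.basis_list_pair_change[OF bV]) (use 2 in simp)
    then have "basis_list (scale1 W) [r1 *\<^sub>V d, e]" by simp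
    \<comment> \<open>The old \<open>y\<close> moves to the last row; scaling it and
      \<open>a\<close> makes all three diagonal products equal to \<open>r1 d\<close>.\<close>
    moreover have "products x z ((r1 / q) *\<^sub>E y) (r1 *\<^sub>U a) b1 c =
        [[r1 *\<^sub>V d, e, 0], [0, r1 *\<^sub>V d, e], [0, 0, r1 *\<^sub>V d]]"
      using 2 by (simp add: products_def acts acts1 fa)
    ultimately show ?thesis unfolding has_normal_form_def by blast
  next
    case 3
    have "products x z (inverse q *\<^sub>E y) a b1 c = [[d, e, 0], [0, 0, e], [0, 0, d]]"
      using 3 by (simp add: products_def acts acts1 fa)
    then show ?thesis using bV unfolding has_normal_form_def by blast
  qed
qed

text \<open>With Q the identity, P has rows (0, q) and (0, s), hence eigenvalues 0 and s. It is
  diagonalisable with distinct eigenvalues, a nonzero nilpotent block, or zero.\<close>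

lemma normal_form_rank_2:
  assumes fr: "frame x y z a b c d e"
    and acts: "x \<bullet> b = 0" "x \<bullet> c = 0" "y \<bullet> b = e" "y \<bullet> c = q *\<^sub>V d" "z \<bullet> b = 0" "z \<bullet> c = s *\<^sub>V d + e"
  shows has_normal_form
proof -
  have bE: "basis_list sE [x, y, z]" and bU: "basis_list (scale0 W) [a, b, c]"
    and bV: "basis_list (scale1 W) [d, e]" and fa: "x \<bullet> a = d" "y \<bullet> a = 0" "z \<bullet> a = 0"
    using fr by (simp_all add: frame_def)
  have "\<not> (s = 0 \<and> q = 0)"
  proof
    assume sq: "s = 0 \<and> q = 0"
    \<comment> \<open>For P = 0 the bristle generated by \<open>a\<close> is a direct summand, and
      this is the projection onto it.\<close>
    obtain f where f: "Vector_Spaces.linear (scale0 W) (scale0 W) f" "f a = a" "f b = 0" "f c = 0"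
      using UU.linear_extend_triple[OF bU] by blast
    obtain g where g: "Vector_Spaces.linear (scale1 W) (scale1 W) g" "g d = d" "g e = 0"
      using VV.linear_extend_pair[OF bV] by blast
    note lin = VV.linear_add[OF g(1)] VV.linear_scale[OF g(1)] VV.linear_0[OF g(1)]
    have "\<exists>k. f = scale0 W k \<and> g = scale1 W k"
      by (rule endomorphism_on_basis[OF bE bU f(1) g(1)]) (auto simp: lin f(2-) g(2-) fa acts sq)
    then obtain k where k: "f = scale0 W k" by blast
    then have "k = 0" using f(3) U.basis_list_triple_independent(8)[OF bU] by simp
    then show False using f(2) U.basis_list_triple_independent(7)[OF bU] by (simp add: k)
  qed
  then consider "s \<noteq> 0" | "s = 0" "q \<noteq> 0" by blast
  then show ?thesis
  proof cases
    case 1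
    have "basis_list (scale1 W) [s *\<^sub>V d + 0 *\<^sub>V e, 0 *\<^sub>V d + 1 *\<^sub>V e]"
      by (rule V.basis_list_pair_change[OF bV]) (use 1 in simp)
    then have "basis_list (scale1 W) [s *\<^sub>V d, e]" by simp
    \<comment> \<open>\<open>c + (q / s) b\<close> is the eigenvector of P for s, and
      \<open>b\<close> the one for 0; \<open>z\<close> and \<open>y - (q / s) z\<close> form the
      dual choice, each killing the other's eigenvector.\<close>
    moreover have "products x z (y - (q / s) *\<^sub>E z) (s *\<^sub>U a) (c + (q / s) *\<^sub>U b) b =
        [[s *\<^sub>V d, 0, 0], [0, s *\<^sub>V d + e, 0], [0, 0, e]]"
      using 1 by (simp add: products_def acts fa V.scale_right_distrib)
    ultimately show ?thesis unfolding has_normal_form_def by blast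
  next
    case 2
    have "basis_list (scale1 W) [0 *\<^sub>V d + 1 *\<^sub>V e, q *\<^sub>V d + 0 *\<^sub>V e]"
      by (rule V.basis_list_pair_change[OF bV]) (use 2 in simp)
    then have "basis_list (scale1 W) [e, q *\<^sub>V d]" by simp
    \<comment> \<open>The starting bristle takes the place of \<open>c\<close> in the type 2 table
      here, whereas in rank one it takes the place of \<open>a\<close>.\<close>
    moreover have "products y z x b c (q *\<^sub>U a) = [[e, q *\<^sub>V d, 0], [0, e, 0], [0, 0, q *\<^sub>V d]]"
      using 2 by (simp add: products_def acts fa)
    ultimately show ?thesis unfolding has_normal_form_def by blast
  qed
qed

end

locale special_module_alg_closed = special_module sE W BE BU BV
  for sE :: "'k::alg_closed_field \<Rightarrow> 'e::ab_group_add \<Rightarrow> 'e" (infixr "*\<^sub>E" 75)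
    and W :: "('k, 'e, 'u::ab_group_add, 'v::ab_group_add) K3_data"
    and BE BU BV
begin

text \<open>\<open>P\<close> and \<open>Q\<close> are the two coordinates of the multiplication.
  Either \<open>Q\<close> is itself singular, or the determinant of P + tQ is a genuine cubic and
  has a root.\<close>

lemma exists_bristle: "\<exists>m v. m \<noteq> 0 \<and> range (\<lambda>e. e \<bullet> m) \<subseteq> V.span {v}"
proof -
  obtain x a where "x \<bullet> a \<noteq> 0" using exists_act_nonzero by blast
  then have "x \<noteq> 0" "a \<noteq> 0" by auto
  obtain y z where bE: "basis_list sE [x, y, z]" using E.extend_basis_triple[OF dim_E \<open>x \<noteq> 0\<close>] .
  obtain b c where bU: "basis_list (scale0 W) [a, b, c]" using U.extend_basis_triple[OF dim_U \<open>a \<noteq> 0\<close>] .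
  obtain v where bV: "basis_list (scale1 W) [x \<bullet> a, v]" using V.extend_basis_pair[OF dim_V \<open>x \<bullet> a \<noteq> 0\<close>] .
  define u where "u = x \<bullet> a"
  have "\<exists>p q. e \<bullet> m = p *\<^sub>V u + q *\<^sub>V v" for e m
    using V.basis_list_pairD(2)[OF bV] unfolding u_def by blast
  then obtain P Q where PQ: "\<And>e m. e \<bullet> m = P e m *\<^sub>V u + Q e m *\<^sub>V v" by metis
  note acts = PQ[of x a] PQ[of x b] PQ[of x c] PQ[of y a] PQ[of y b] PQ[of y c] PQ[of z a] PQ[of z b] PQ[of z c]
  show ?thesis
  proof (cases "Q x a * (Q y b * Q z c - Q y c * Q z b) - Q x b * (Q y a * Q z c - Q y c * Q z a)
      + Q x c * (Q y a * Q z b - Q y b * Q z a) = 0")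
    case True
    \<comment> \<open>The summands are swapped so that the singular matrix \<open>Q\<close> belongs
      to the coordinate that is to vanish; the bristle then maps into the line of
      \<open>u\<close>.\<close>
    show ?thesis
      using bristle_of_singular_matrix[OF bE bU acts[unfolded add.commute[of "_ *\<^sub>V u"]] True] by blast
  next
    case False
    \<comment> \<open>In the basis \<open>u, w t\<close> the coefficient at \<open>u\<close> becomes
      P + tQ, so a singular value of \<open>t\<close> yields a bristle over the line of
      \<open>w t\<close>.\<close>
    define w where "w t = v - t *\<^sub>V u" for t
    obtain t where t: "(P x a + t * Q x a) * ((P y b + t * Q y b) * (P z c + t * Q z c) - (P y c + t * Q y c) * (P z b + t * Q z b))
        - (P x b + t * Q x b) * ((P y a + t * Q y a) * (P z c + t * Q z c) - (P y c + t * Q y c) * (P z a + t * Q z a))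
        + (P x c + t * Q x c) * ((P y a + t * Q y a) * (P z b + t * Q z b) - (P y b + t * Q y b) * (P z a + t * Q z a)) = 0"
      using pencil_3_singular[OF False] by blast
    have "e \<bullet> m = (P e m + t * Q e m) *\<^sub>V u + Q e m *\<^sub>V w t" for e m
      by (subst PQ) (simp add: w_def V.scale_right_diff_distrib V.scale_left_distrib mult.commute)
    from bristle_of_singular_matrix[OF bE bU this this this this this this this this this t]
    show ?thesis by blast
  qed
qed

theorem normal_form: has_normal_form
proof -
  obtain a v where "a \<noteq> 0" "range (\<lambda>e. e \<bullet> a) \<subseteq> V.span {v}" using exists_bristle by blast
  from exists_frame[OF this] obtain x y z b c d e where fr: "frame x y z a b c d e" by (elim exE)
  obtain p1 q1 p2 q2 p3 q3 p4 q4 where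
    acts: "y \<bullet> b = p1 *\<^sub>V d + q1 *\<^sub>V e" "y \<bullet> c = p2 *\<^sub>V d + q2 *\<^sub>V e"
      "z \<bullet> b = p3 *\<^sub>V d + q3 *\<^sub>V e" "z \<bullet> c = p4 *\<^sub>V d + q4 *\<^sub>V e"
    using frame_coordinates[OF fr] by meson
  show ?thesis
  proof (cases "q1 * q4 - q2 * q3 = 0")
    case True
    then have "q1 * q4 = q2 * q3" by simp
    from frame_rank_1[OF fr acts this] show ?thesis
      by (elim exE conjE) (rule normal_form_rank_1)
  next
    case False
    obtain t where "(p1 + t * q1) * (p4 + t * q4) = (p2 + t * q2) * (p3 + t * q3)"
      using pencil_2_singular[OF False] by blast
    from frame_rank_2[OF fr acts False this] show ?thesis
      by (elim exE conjE) (rule normal_form_rank_2)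
  qed
qed

end

theorem proposition4p2:
  fixes sE :: "'k::alg_closed_field \<Rightarrow> 'e::ab_group_add \<Rightarrow> 'e"
    and W :: "('k, 'e, 'u::ab_group_add, 'v::ab_group_add) K3_data"
  assumes "special sE W"
  shows
    "bristle_type W \<in> {1, 2, 3, \<infinity>} \<and>
     (bristle_type W = 1 \<longrightarrow>
       (\<exists>x y z a b c d e.
          basis_list sE [x, y, z] \<and> basis_list (scale0 W) [a, b, c] \<and> basis_list (scale1 W) [d, e] \<and>
          act W x a = d \<and> act W x b = e \<and> act W x c = 0 \<and>
          act W y a = 0 \<and> act W y b = d \<and> act W y c = e \<and>
          act W z a = 0 \<and> act W z b = 0 \<and> act W z c = d \<and>
          subbristles W = {generated W a} \<and>
          bars W = {(module.span (scale0 W) {a, b}, UNIV)} \<and>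
          annihilator W (module.span (scale0 W) {a, b}, UNIV) = module.span sE {z})) \<and>
     (bristle_type W = 2 \<longrightarrow>
       (\<exists>x y z a b c d e.
          basis_list sE [x, y, z] \<and> basis_list (scale0 W) [a, b, c] \<and> basis_list (scale1 W) [d, e] \<and>
          act W x a = d \<and> act W x b = e \<and> act W x c = 0 \<and>
          act W y a = 0 \<and> act W y b = d \<and> act W y c = 0 \<and>
          act W z a = 0 \<and> act W z b = 0 \<and> act W z c = e \<and>
          subbristles W = {generated W a, generated W c} \<and>
          bars W = {(module.span (scale0 W) {a, b}, UNIV), (module.span (scale0 W) {a, c}, UNIV)} \<and>
          annihilator W (module.span (scale0 W) {a, b}, UNIV) = module.span sE {z} \<and>
          annihilator W (module.span (scale0 W) {a, c}, UNIV) = module.span sE {y})) \<and>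
     (bristle_type W = 3 \<longrightarrow>
       (\<exists>x y z a b c d e.
          basis_list sE [x, y, z] \<and> basis_list (scale0 W) [a, b, c] \<and> basis_list (scale1 W) [d, e] \<and>
          act W x a = d \<and> act W x b = 0 \<and> act W x c = 0 \<and>
          act W y a = 0 \<and> act W y b = d + e \<and> act W y c = 0 \<and>
          act W z a = 0 \<and> act W z b = 0 \<and> act W z c = e \<and>
          subbristles W = {generated W a, generated W b, generated W c} \<and>
          bars W = {(module.span (scale0 W) {a, b}, UNIV), (module.span (scale0 W) {a, c}, UNIV),
                    (module.span (scale0 W) {b, c}, UNIV)} \<and>
          annihilator W (module.span (scale0 W) {a, b}, UNIV) = module.span sE {z} \<and>
          annihilator W (module.span (scale0 W) {a, c}, UNIV) = module.span sE {y} \<and>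
          annihilator W (module.span (scale0 W) {b, c}, UNIV) = module.span sE {x})) \<and>
     (bristle_type W = \<infinity> \<longrightarrow>
       (\<exists>x y z a b c d e.
          basis_list sE [x, y, z] \<and> basis_list (scale0 W) [a, b, c] \<and> basis_list (scale1 W) [d, e] \<and>
          act W x a = d \<and> act W x b = e \<and> act W x c = 0 \<and>
          act W y a = 0 \<and> act W y b = 0 \<and> act W y c = e \<and>
          act W z a = 0 \<and> act W z b = 0 \<and> act W z c = d \<and>
          subbristles W = generated W ` (module.span (scale0 W) {a, b} - {0}) \<and>
          bars W = {(module.span (scale0 W) {a, b}, UNIV)} \<and>
          annihilator W (module.span (scale0 W) {a, b}, UNIV) = module.span sE {y, z}))"
proof -
  obtain BE BU BV where "special_module sE W BE BU BV"
    using special_imp_special_module[OF assms] .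
  then interpret special_module_alg_closed sE W BE BU BV by (simp add: special_module_alg_closed_def)
  obtain x y z a b c d e where bV: "basis_list (scale1 W) [d, e]"
    and tables: "products x y z a b c \<in>
      {[[d, e, 0], [0, d, e], [0, 0, d]],
       [[d, e, 0], [0, d, 0], [0, 0, e]],
       [[d, 0, 0], [0, d + e, 0], [0, 0, e]],
       [[d, e, 0], [0, 0, e], [0, 0, d]]}"
    using normal_form unfolding has_normal_form_def by metis
  \<comment> \<open>Rewriting the numerals as \<open>enat\<close> values separates 1, 2, 3 and
    infinity, so in each case the three implications for the other types hold vacuously.\<close>
  note distinct_types = one_enat_def numeral_eq_enat
  from tables consider
      (one) "products x y z a b c = [[d, e, 0], [0, d, e], [0, 0, d]]"
    | (two) "products x y z a b c = [[d, e, 0], [0, d, 0], [0, 0, e]]"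
    | (three) "products x y z a b c = [[d, 0, 0], [0, d + e, 0], [0, 0, e]]"
    | (infinite) "products x y z a b c = [[d, e, 0], [0, 0, e], [0, 0, d]]"
    by blast
  then show ?thesis
  proof cases
    case one
    then have table: "act W x a = d" "act W x b = e" "act W x c = 0" "act W y a = 0" "act W y b = d"
      "act W y c = e" "act W z a = 0" "act W z b = 0" "act W z c = d" by (simp_all add: products_def)
    note t = table_type_1[OF bV table]
    show ?thesis unfolding t(6)
      by (intro conjI impI, simp add: distinct_types,
          rule exI[of _ x], rule exI[of _ y], rule exI[of _ z], rule exI[of _ a], rule exI[of _ b],
          rule exI[of _ c], rule exI[of _ d], rule exI[of _ e], simp add: bV table t, simp_all add: distinct_types)
  next
    case two
    then have table: "act W x a = d" "act W x b = e" "act W x c = 0" "act W y a = 0" "act W y b = d"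
      "act W y c = 0" "act W z a = 0" "act W z b = 0" "act W z c = e" by (simp_all add: products_def)
    note t = table_type_2[OF bV table]
    show ?thesis unfolding t(7)
      by (intro conjI impI, simp add: distinct_types, simp add: distinct_types,
          rule exI[of _ x], rule exI[of _ y], rule exI[of _ z], rule exI[of _ a], rule exI[of _ b],
          rule exI[of _ c], rule exI[of _ d], rule exI[of _ e], simp add: bV table t, simp_all add: distinct_types)
  next
    case three
    then have table: "act W x a = d" "act W x b = 0" "act W x c = 0" "act W y a = 0" "act W y b = d + e"
      "act W y c = 0" "act W z a = 0" "act W z b = 0" "act W z c = e" by (simp_all add: products_def)
    note t = table_type_3[OF bV table]
    show ?thesis unfolding t(8)
      by (intro conjI impI, simp add: distinct_types, simp add: distinct_types, simp add: distinct_types,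
          rule exI[of _ x], rule exI[of _ y], rule exI[of _ z], rule exI[of _ a], rule exI[of _ b],
          rule exI[of _ c], rule exI[of _ d], rule exI[of _ e], simp add: bV table t, simp_all add: distinct_types)
  next
    case infinite
    then have table: "act W x a = d" "act W x b = e" "act W x c = 0" "act W y a = 0" "act W y b = 0"
      "act W y c = e" "act W z a = 0" "act W z b = 0" "act W z c = d" by (simp_all add: products_def)
    note t = table_type_infinity[OF bV alg_closed_field_infinite table]
    show ?thesis unfolding t(6)
      by (intro conjI impI, simp add: distinct_types, simp add: distinct_types, simp add: distinct_types, simp add: distinct_types,
          rule exI[of _ x], rule exI[of _ y], rule exI[of _ z], rule exI[of _ a], rule exI[of _ b],
          rule exI[of _ c], rule exI[of _ d], rule exI[of _ e], simp add: bV table t)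
  qed
qed

end
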